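(* Let $\Lambda$ be the set of irrational $x\in[0,1)$ whose partial quotients $\{a_n(x)\}_{n\ge1}$ are non-decreasing and satisfy $a_n(x)\to\infty$. Then for every $\alpha\ge0$, $$\dim_{\rm H}\{x\in\Lambda:\tau(x)=\alpha\}=\begin{cases}(1-\alpha)/2,&0\le\alpha\le1,\\0,&\alpha>1.\end{cases}$$
   Context: For irrational $x\in[0,1)$ let $x=[a_1(x),a_2(x),\dots]$ be its (infinite) continued fraction expansion with positive integer partial quotients $a_n(x)$. Define $\tau(x):=\inf\{s\ge0:\sum_{n\ge1}a_n(x)^{-s}<\infty\}\in[0,\infty]$. $\dim_{\rm H}$ denotes Hausdorff dimension. *)

theory Defs
  imports "HOL-Analysis.Analysis"
begin

section \<open>Hausdorff measure and dimension\<close>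

text \<open>
  The weight \<open>(diam U)\<^sup>s\<close>, with the conventions that the empty set has weight 0 for every \<open>s\<close> and that
  a nonempty set has weight 1 for \<open>s = 0\<close>. The case distinction is needed because
  \<open>0 powr 0 = 0\<close>; it makes the measure for \<open>s = 0\<close> the counting measure.
\<close>

definition diam_weight :: "real \<Rightarrow> 'a::metric_space set \<Rightarrow> real" where
  "diam_weight s U = (if U = {} then 0 else if s = 0 then 1 else diameter U powr s)"

text \<open>
  Finite covers are included, since members of the sequence may be empty. Boundedness is
  required because \<^const>\<open>diameter\<close> is meaningless on unbounded sets.
\<close>

definition delta_covers :: "real \<Rightarrow> 'a::metric_space set \<Rightarrow> (nat \<Rightarrow> 'a set) set" where
  "delta_covers \<delta> A = {U. A \<subseteq> (\<Union>i. U i) \<and> (\<forall>i. bounded (U i) \<and> diameter (U i) \<le> \<delta>)}"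

definition hausdorff_premeasure :: "real \<Rightarrow> real \<Rightarrow> 'a::metric_space set \<Rightarrow> ennreal" where
  "hausdorff_premeasure s \<delta> A = (INF U\<in>delta_covers \<delta> A. \<Sum>i. ennreal (diam_weight s (U i)))"

definition hausdorff_measure :: "real \<Rightarrow> 'a::metric_space set \<Rightarrow> ennreal" where
  "hausdorff_measure s A = (SUP \<delta>\<in>{0<..}. hausdorff_premeasure s \<delta> A)"

definition hausdorff_dim :: "'a::metric_space set \<Rightarrow> ennreal" where
  "hausdorff_dim A = (INF s\<in>{s. 0 \<le> s \<and> hausdorff_measure s A = 0}. ennreal s)"


section \<open>Continued fractions\<close>

definition gauss_map :: "real \<Rightarrow> real" where
  "gauss_map x = frac (1 / x)"

text \<open>
  The partial quotient \<open>a\<^sub>n(x)\<close> of \<open>x = [a\<^sub>1(x), a\<^sub>2(x), \<dots>]\<close>. Indices start at 1; the value at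
  \<open>n = 0\<close> is an artefact of truncated subtraction and is never used.
\<close>

definition cf_quotient :: "nat \<Rightarrow> real \<Rightarrow> nat" where
  "cf_quotient n x = nat \<lfloor>1 / (gauss_map ^^ (n - 1)) x\<rfloor>"

lemma gauss_map_irrational:
  assumes "x \<notin> \<rat>"
  shows "gauss_map x \<notin> \<rat>" "gauss_map x \<in> {0<..<1}"
proof -
  show *: "gauss_map x \<notin> \<rat>"
  proof
    assume "gauss_map x \<in> \<rat>"
    then have "gauss_map x + of_int \<lfloor>1 / x\<rfloor> \<in> \<rat>"
      by (intro Rats_add) auto
    then have "1 / x \<in> \<rat>"
      by (simp add: gauss_map_def frac_def)
    then have "x \<in> \<rat>"
      by (metis Rats_inverse inverse_eq_divide inverse_inverse_eq)
    with assms show False by simp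
  qed
  have "gauss_map x \<noteq> 0" using * by (metis Rats_0)
  then show "gauss_map x \<in> {0<..<1}"
    using frac_ge_0[of "1 / x"] frac_lt_1[of "1 / x"] by (simp add: gauss_map_def)
qed

lemma cf_quotient_unfold:
  assumes "x \<in> {0<..<1}"
  shows "x = 1 / (real (cf_quotient 1 x) + gauss_map x)" "cf_quotient 1 x \<ge> 1"
proof -
  have "1 \<le> \<lfloor>1 / x\<rfloor>" using assms by (simp add: field_simps)
  moreover from this have "real (cf_quotient 1 x) = of_int \<lfloor>1 / x\<rfloor>"
    unfolding cf_quotient_def by (simp del: one_le_floor)
  ultimately show "x = 1 / (real (cf_quotient 1 x) + gauss_map x)" "cf_quotient 1 x \<ge> 1"
    by (auto simp: gauss_map_def frac_def cf_quotient_def simp del: one_le_floor)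
qed

lemma cf_quotient_gauss_map:
  "n \<ge> 1 \<Longrightarrow> cf_quotient n (gauss_map x) = cf_quotient (Suc n) x"
  by (cases n) (simp_all add: cf_quotient_def funpow_swap1)

text \<open>The infimum is \<open>\<infinity>\<close> if the series diverges for every \<open>s \<ge> 0\<close>.\<close>

definition conv_exponent :: "real \<Rightarrow> ennreal" where
  "conv_exponent x =
     (INF s\<in>{s. 0 \<le> s \<and> summable (\<lambda>n. real (cf_quotient (Suc n) x) powr (-s))}. ennreal s)"

definition nondecreasing_cf_set :: "real set" where
  "nondecreasing_cf_set =
     {x \<in> {0..<1}. x \<notin> \<rat> \<and> mono_on {1..} (\<lambda>n. cf_quotient n x) \<and>
        filterlim (\<lambda>n. cf_quotient n x) at_top sequentially}"

end

theory Submission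
  imports Defs "HOL-Probability.Infinite_Product_Measure"
begin

text \<open>
  Upper bound: if \<open>\<tau>(x) = \<alpha>\<close> and \<open>\<beta> < \<alpha>\<close> (or \<open>\<beta> = \<alpha> = 0\<close>), then \<open>a\<^sub>n(x)\<^sup>\<beta> \<le> n\<close> for infinitely many \<open>n\<close>.
  The cylinder of a word \<open>w\<close> has diameter at most \<open>\<Prod> w\<^sub>i\<close> to the power \<open>-2\<close>, and the quotients are
  non-decreasing, so the \<open>s\<close>-weights of the relevant cylinders of length \<open>n\<close> sum to a complete
  homogeneous symmetric polynomial in the \<open>k\<^bsup>-2s\<^esup>\<close> with \<open>k\<^sup>\<beta> \<le> n\<close>. Its generating function bounds it
  by a geometric sequence as soon as \<open>2s + \<beta> > 1\<close>, and a Borel-Cantelli argument applies.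

  Lower bound: let the \<open>n\<close>-th quotient range over a block \<open>{g n..<g (n + 1)}\<close>, where \<open>g n\<close> is about
  \<open>n\<^bsup>1/\<alpha>\<^esup>\<close> (or \<open>2\<^sup>n\<close> for \<open>\<alpha> = 0\<close>). This forces monotonicity and \<open>\<tau> = \<alpha>\<close>, and the product of the uniform
  distributions on the blocks satisfies the mass distribution principle for every \<open>s < (1 - \<alpha>)/2\<close>.
\<close>

section \<open>Sets of Hausdorff measure zero\<close>

text \<open>The covers come from the single scale 1. This direction also holds for
  \<open>s = 0\<close>, a case that the lower bound includes.\<close>

lemma hausdorff_measure_eq_0D:
  assumes "hausdorff_measure s A = 0" "e > 0"
  shows "\<exists>U::nat \<Rightarrow> 'a::metric_space set. A \<subseteq> (\<Union>i. U i) \<and> (\<forall>i. bounded (U i)) \<and>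
       (\<Sum>i. ennreal (diam_weight s (U i))) \<le> ennreal e"
proof -
  have "hausdorff_premeasure s 1 A = 0"
    using assms(1) by (auto simp: hausdorff_measure_def SUP_eq_iff bot_ennreal)
  then have "(INF U\<in>delta_covers 1 A. \<Sum>i. ennreal (diam_weight s (U i))) < ennreal e"
    using assms(2) by (simp add: hausdorff_premeasure_def)
  then obtain U where "U \<in> delta_covers 1 A" "(\<Sum>i. ennreal (diam_weight s (U i))) < ennreal e"
    unfolding INF_less_iff by blast
  then show ?thesis by (intro exI[of _ U]) (simp add: delta_covers_def)
qed

text \<open>For \<open>s > 0\<close>, a cover of total weight at most \<open>d powr s\<close>
  consists of sets of diameter at most \<open>d\<close>, so the mesh condition comes for
  free.\<close>

lemma hausdorff_measure_eq_0_iff: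
  fixes A :: "'a::metric_space set"
  assumes "s > 0"
  shows "hausdorff_measure s A = 0 \<longleftrightarrow>
    (\<forall>e>0. \<exists>U::nat \<Rightarrow> 'a set. A \<subseteq> (\<Union>i. U i) \<and> (\<forall>i. bounded (U i)) \<and>
       (\<Sum>i. ennreal (diam_weight s (U i))) \<le> ennreal e)" (is "_ \<longleftrightarrow> ?R")
proof
  assume "hausdorff_measure s A = 0"
  then show ?R by (intro allI impI hausdorff_measure_eq_0D)
next
  assume R: ?R
  have "hausdorff_premeasure s d A = 0" if "d > 0" for d
  proof -
    have "hausdorff_premeasure s d A \<le> 0 + ennreal e" if "e > 0" for e
    proof -
      have "min e (d powr s) > 0" using \<open>e > 0\<close> \<open>d > 0\<close> by simp
      then obtain U :: "nat \<Rightarrow> 'a set" where U: "A \<subseteq> (\<Union>i. U i)" "\<And>i. bounded (U i)"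
        "(\<Sum>i. ennreal (diam_weight s (U i))) \<le> ennreal (min e (d powr s))"
        using R by metis
      have "diameter (U i) \<le> d" for i
      proof (cases "U i = {}")
        case False
        have "ennreal (diam_weight s (U i)) \<le> (\<Sum>i. ennreal (diam_weight s (U i)))"
          using sum_le_suminf[of "\<lambda>i. ennreal (diam_weight s (U i))" "{i}"] by simp
        also have "\<dots> \<le> ennreal (min e (d powr s))" by (rule U(3))
        finally have "diameter (U i) powr s \<le> d powr s"
          using False \<open>s > 0\<close> by (auto simp: diam_weight_def ennreal_le_iff2 split: if_splits)
        then show ?thesis
          using \<open>s > 0\<close> \<open>d > 0\<close> powr_less_mono2[of s d "diameter (U i)"] by force
      qed (use \<open>d > 0\<close> in simp)
      then have "U \<in> delta_covers d A" using U by (auto simp: delta_covers_def)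
      then have "hausdorff_premeasure s d A \<le> ennreal (min e (d powr s))"
        unfolding hausdorff_premeasure_def using U(3) by (meson INF_lower2)
      also have "\<dots> \<le> ennreal e" by (simp add: ennreal_leI)
      finally show ?thesis by simp
    qed
    then have "hausdorff_premeasure s d A \<le> 0"
      by (rule ennreal_le_epsilon)
    then show ?thesis by simp
  qed
  then show "hausdorff_measure s A = 0"
    by (auto simp: hausdorff_measure_def intro!: antisym SUP_least)
qed

text \<open>The n-th set is covered with weight at most \<open>e / 2 ^ (n + 1)\<close>. The general
  countable index serves unions over finite words and, at type \<open>unit\<close>, monotonicity in
  the set.\<close>

lemma hausdorff_measure_UN_null:
  fixes A :: "'i::countable \<Rightarrow> 'a::metric_space set"
  assumes "s > 0" "\<And>i. hausdorff_measure s (A i) = 0" "B \<subseteq> (\<Union>i. A i)"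
  shows "hausdorff_measure s B = 0"
  unfolding hausdorff_measure_eq_0_iff[OF \<open>s > 0\<close>]
proof (intro allI impI)
  fix e :: real assume "e > 0"
  \<comment> \<open>Indices are moved to \<open>nat\<close>; numbers that code no index get the
    empty set.\<close>
  define A' where "A' n = (if n \<in> range (to_nat :: 'i \<Rightarrow> nat) then A (from_nat n) else {})" for n
  have "hausdorff_measure s (A' n) = 0" for n
    using assms(1,2) hausdorff_measure_eq_0_iff[OF \<open>s > 0\<close>, of "{} :: 'a set"]
    by (auto simp: A'_def diam_weight_def intro!: exI[of _ "\<lambda>_. {}"])
  moreover have "e * (1/2) ^ Suc n > 0" for n using \<open>e > 0\<close> by simp
  ultimately have "\<exists>U::nat \<Rightarrow> 'a set. A' n \<subseteq> (\<Union>i. U i) \<and> (\<forall>i. bounded (U i)) \<and>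
       (\<Sum>i. ennreal (diam_weight s (U i))) \<le> ennreal (e * (1/2) ^ Suc n)" for n
    using hausdorff_measure_eq_0_iff[OF \<open>s > 0\<close>, of "A' n"] by blast
  then obtain U :: "nat \<Rightarrow> nat \<Rightarrow> 'a set" where U: "\<And>n. A' n \<subseteq> (\<Union>i. U n i)"
    "\<And>n i. bounded (U n i)" "\<And>n. (\<Sum>i. ennreal (diam_weight s (U n i))) \<le> ennreal (e * (1/2) ^ Suc n)"
    by metis
  define V where "V k = (case prod_decode k of (n, i) \<Rightarrow> U n i)" for k
  have "(\<Sum>k. ennreal (diam_weight s (V k))) = (\<Sum>n. \<Sum>i. ennreal (diam_weight s (U n i)))"
    using suminf_ennreal_2dimen[of "\<lambda>n. \<Sum>i. ennreal (diam_weight s (U n i))"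
        "\<lambda>(n, i). ennreal (diam_weight s (U n i))"]
    by (simp add: V_def split_def)
  also have "\<dots> \<le> (\<Sum>n. ennreal (e * (1/2) ^ Suc n))"
    by (intro suminf_le U) auto
  also have "\<dots> = ennreal e"
    using sums_mult[OF power_half_series, of e] \<open>e > 0\<close>
    by (intro suminf_ennreal_eq) auto
  finally have "(\<Sum>k. ennreal (diam_weight s (V k))) \<le> ennreal e" .
  moreover have "B \<subseteq> (\<Union>k. V k)"
  proof
    fix x assume "x \<in> B"
    then obtain i where "x \<in> A i" using assms(3) by auto
    then have "x \<in> A' (to_nat i)" by (simp add: A'_def)
    then obtain j where "x \<in> U (to_nat i) j" using U(1) by blast
    then have "x \<in> V (prod_encode (to_nat i, j))" by (simp add: V_def)
    then show "x \<in> (\<Union>k. V k)" by blast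
  qed
  moreover have "bounded (V k)" for k by (simp add: V_def split_def U)
  ultimately show "\<exists>U::nat \<Rightarrow> 'a set. B \<subseteq> (\<Union>i. U i) \<and> (\<forall>i. bounded (U i)) \<and>
       (\<Sum>i. ennreal (diam_weight s (U i))) \<le> ennreal e" by blast
qed

lemma diam_weight_nonneg: "0 \<le> diam_weight s U"
  by (simp add: diam_weight_def)

text \<open>The convergence half of the Borel-Cantelli lemma: dropping finitely many indices still
  leaves a cover of \<open>A\<close>, and its total weight is a tail of a convergent sum.\<close>

lemma hausdorff_measure_limsup_null:
  fixes U :: "'i::countable \<Rightarrow> 'a::metric_space set"
  assumes "s > 0" "(\<lambda>i. diam_weight s (U i)) summable_on I" "\<And>i. i \<in> I \<Longrightarrow> bounded (U i)"
    and inf: "\<And>x. x \<in> A \<Longrightarrow> infinite {i \<in> I. x \<in> U i}"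
  shows "hausdorff_measure s A = 0"
  unfolding hausdorff_measure_eq_0_iff[OF \<open>s > 0\<close>]
proof (intro allI impI)
  fix e :: real assume "e > 0"
  let ?f = "\<lambda>i. diam_weight s (U i)"
  have "(sum ?f \<longlongrightarrow> infsum ?f I) (finite_subsets_at_top I)"
    using assms(2) infsum_tendsto by blast
  then have "eventually (\<lambda>F. dist (sum ?f F) (infsum ?f I) < e) (finite_subsets_at_top I)"
    using \<open>e > 0\<close> by (rule tendstoD)
  then obtain F where F: "finite F" "F \<subseteq> I" "dist (sum ?f F) (infsum ?f I) < e"
    unfolding eventually_finite_subsets_at_top by blast
  define J where "J = I - F"
  have sJ: "?f summable_on J"
    using assms(2) unfolding J_def by (rule summable_on_subset_banach) auto
  have "infsum ?f J = infsum ?f I - sum ?f F"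
    unfolding J_def using F assms(2) by (subst infsum_Diff) auto
  then have J: "infsum ?f J \<le> e" using F(3) by (auto simp: dist_real_def)
  \<comment> \<open>The remaining indices are listed along their codes in \<open>nat\<close>; the
    gaps carry the empty set, of weight 0.\<close>
  define N where "N = (to_nat :: 'i \<Rightarrow> nat) ` J"
  define V where "V n = (if n \<in> N then U (from_nat n) else {})" for n
  have eq: "(\<Sum>k<n. diam_weight s (V k)) \<le> e" for n
  proof -
    have "(\<Sum>k<n. diam_weight s (V k)) = (\<Sum>k\<in>{..<n} \<inter> N. diam_weight s (U (from_nat k)))"
      by (subst sum.inter_restrict) (auto simp: V_def diam_weight_def intro!: sum.cong)
    also have "\<dots> = (\<Sum>i\<in>from_nat ` ({..<n} \<inter> N). ?f i)"
      by (subst sum.reindex) (auto simp: N_def inj_on_def)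
    also have "\<dots> \<le> infsum ?f J"
      by (rule finite_sum_le_infsum[OF sJ]) (auto simp: N_def diam_weight_nonneg)
    finally show ?thesis using J by simp
  qed
  have "(\<Sum>k. ennreal (diam_weight s (V k))) \<le> ennreal e"
    unfolding suminf_eq_SUP
    by (rule SUP_least) (use eq in \<open>auto simp: diam_weight_nonneg intro!: ennreal_leI\<close>)
  moreover have "bounded (V k)" for k
    using assms(3) by (auto simp: V_def N_def J_def)
  moreover have "A \<subseteq> (\<Union>k. V k)"
  proof
    fix x assume "x \<in> A"
    then have "\<not> {i \<in> I. x \<in> U i} \<subseteq> F" using inf F(1) finite_subset by blast
    then obtain i where i: "i \<in> J" "x \<in> U i" by (auto simp: J_def)
    then have "x \<in> V (to_nat i)" by (auto simp: V_def N_def)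
    then show "x \<in> (\<Union>k. V k)" by blast
  qed
  ultimately show "\<exists>U::nat \<Rightarrow> 'a set. A \<subseteq> (\<Union>i. U i) \<and> (\<forall>i. bounded (U i)) \<and>
       (\<Sum>i. ennreal (diam_weight s (U i))) \<le> ennreal e" by blast
qed

section \<open>Cylinders\<close>

definition cf_cylinder :: "nat list \<Rightarrow> real set" where
  "cf_cylinder w = {x \<in> {0<..<1}. x \<notin> \<rat> \<and> (\<forall>i<length w. cf_quotient (Suc i) x = w ! i)}"

lemma cf_cylinder_Cons:
  assumes "x \<in> cf_cylinder (a # w)"
  shows "gauss_map x \<in> cf_cylinder w" "x = 1 / (real a + gauss_map x)" "a \<ge> 1"
proof -
  have x: "x \<in> {0<..<1}" "x \<notin> \<rat>" "cf_quotient 1 x = a"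
    "\<And>i. i < length w \<Longrightarrow> cf_quotient (Suc (Suc i)) x = w ! i"
    using assms by (auto simp: cf_cylinder_def)
  show "gauss_map x \<in> cf_cylinder w"
    using gauss_map_irrational[OF x(2)] x(4) by (auto simp: cf_cylinder_def cf_quotient_gauss_map)
  show "x = 1 / (real a + gauss_map x)" "a \<ge> 1"
    using cf_quotient_unfold[OF x(1)] x(3) by simp_all
qed

text \<open>Used with \<open>a = b\<close> for points that share their first quotient, and with
  independent \<open>a\<close>, \<open>b\<close> at the level where two points may separate.\<close>

lemma inverse_shift_diff:
  fixes a b u v :: real
  assumes "a + u > 0" "b + v > 0"
  shows "\<bar>1 / (a + u) - 1 / (b + v)\<bar> = \<bar>(b + v) - (a + u)\<bar> / ((a + u) * (b + v))"
proof -
  have "1 / (a + u) - 1 / (b + v) = ((b + v) - (a + u)) / ((a + u) * (b + v))"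
    using assms by (simp add: divide_simps)
  then show ?thesis using assms by (simp add: abs_mult)
qed

text \<open>On positive arguments the inverse branch \<open>t \<mapsto> 1 / (a + t)\<close>
  contracts distances by a factor of at least \<open>a\<^sup>2\<close>; a point of the cylinder is
  reached through one such branch per letter.\<close>

lemma cf_cylinder_dist:
  assumes "x \<in> cf_cylinder w" "y \<in> cf_cylinder w"
  shows "\<bar>x - y\<bar> \<le> (\<Prod>a\<leftarrow>w. 1 / (real a)\<^sup>2)"
  using assms
proof (induction w arbitrary: x y)
  case Nil
  then show ?case by (auto simp: cf_cylinder_def)
next
  case (Cons a w)
  note x = cf_cylinder_Cons[OF Cons.prems(1)] and y = cf_cylinder_Cons[OF Cons.prems(2)]
  define u v where "u = gauss_map x" and "v = gauss_map y"
  have uv: "u > 0" "v > 0" "u \<in> cf_cylinder w" "v \<in> cf_cylinder w" "a > 0"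
    using x y by (auto simp: u_def v_def cf_cylinder_def)
  have "\<bar>x - y\<bar> = \<bar>u - v\<bar> / ((real a + u) * (real a + v))"
    using x(2) y(2) inverse_shift_diff[of a u a v] uv by (simp add: u_def v_def abs_minus_commute)
  also have "\<dots> \<le> \<bar>u - v\<bar> / (real a)\<^sup>2"
    unfolding power2_eq_square using uv by (intro divide_left_mono mult_mono) auto
  also have "\<dots> \<le> (\<Prod>a\<leftarrow>w. 1 / (real a)\<^sup>2) / (real a)\<^sup>2"
    using Cons.IH[OF uv(3,4)] by (intro divide_right_mono) auto
  finally show ?case by simp
qed

lemma prod_list_real_nonneg: "(\<And>x. x \<in> set xs \<Longrightarrow> 0 \<le> f x) \<Longrightarrow> 0 \<le> (\<Prod>x\<leftarrow>xs. f x :: real)"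
  by (induction xs) auto

lemma bounded_cf_cylinder: "bounded (cf_cylinder w)"
  by (rule bounded_subset[of "{0..1}"]) (auto simp: cf_cylinder_def)

lemma diameter_cf_cylinder: "diameter (cf_cylinder w) \<le> (\<Prod>a\<leftarrow>w. 1 / (real a)\<^sup>2)"
  by (rule diameter_le) (auto intro: prod_list_real_nonneg dest: cf_cylinder_dist simp: dist_real_def)

text \<open>The prefix contributes a factor of at most 1, so the bound is uniform in
  \<open>p\<close> and can be summed over \<open>w\<close> for each fixed \<open>p\<close>.\<close>

lemma diam_weight_cf_cylinder:
  assumes "s > 0"
  shows "diam_weight s (cf_cylinder (p @ w)) \<le> (\<Prod>a\<leftarrow>w. real a powr (-(2 * s)))"
proof (cases "cf_cylinder (p @ w) = {}")
  case True
  then show ?thesis by (auto simp: diam_weight_def intro: prod_list_real_nonneg)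
next
  case False
  have 1: "(\<Prod>a\<leftarrow>xs. 1 / (real a)\<^sup>2) \<le> 1" for xs :: "nat list"
  proof (induction xs)
    case (Cons a xs)
    have "1 / (real a)\<^sup>2 \<le> 1" by (cases "a = 0") (auto simp: divide_le_eq_1)
    from mult_le_one[OF this _ Cons] show ?case
      by (simp add: prod_list_real_nonneg del: times_divide_eq_left)
  qed simp
  have 2: "(\<Prod>a\<leftarrow>w. 1 / (real a)\<^sup>2) powr s = (\<Prod>a\<leftarrow>w. real a powr (-(2 * s)))"
  proof (induction w)
    case (Cons a w)
    \<comment> \<open>For \<open>a = 0\<close> both sides are 0, because \<open>1 / 0 = 0\<close>
      and \<open>0 powr x = 0\<close>.\<close>
    have "(1 / (real a)\<^sup>2) powr s = real a powr (-(2 * s))"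
      by (cases "a = 0") (simp_all add: powr_divide powr_minus_divide powr_powr flip: powr_numeral)
    then show ?case using Cons by (simp add: powr_mult prod_list_real_nonneg del: times_divide_eq_left)
  qed simp
  have "diam_weight s (cf_cylinder (p @ w)) = diameter (cf_cylinder (p @ w)) powr s"
    using False assms by (simp add: diam_weight_def)
  also have "\<dots> \<le> ((\<Prod>a\<leftarrow>p. 1 / (real a)\<^sup>2) * (\<Prod>a\<leftarrow>w. 1 / (real a)\<^sup>2)) powr s"
    using diameter_cf_cylinder[of "p @ w"] diameter_ge_0[OF bounded_cf_cylinder] assms
    by (intro powr_mono2) auto
  also have "\<dots> \<le> (\<Prod>a\<leftarrow>w. 1 / (real a)\<^sup>2) powr s"
    using 1[of p] assms
    by (intro powr_mono2 mult_left_le_one_le mult_nonneg_nonneg prod_list_real_nonneg) auto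
  finally show ?thesis using 2 by simp
qed


section \<open>Upper bound\<close>

definition sorted_words :: "nat set \<Rightarrow> nat \<Rightarrow> nat list set" where
  "sorted_words K m = {w. sorted w \<and> length w = m \<and> set w \<subseteq> K}"

lemma finite_sorted_words: "finite K \<Longrightarrow> finite (sorted_words K m)"
  by (rule finite_subset[OF _ finite_lists_length_eq[of K m]]) (auto simp: sorted_words_def)

lemma sorted_words_0: "sorted_words K 0 = {[]}"
  by (auto simp: sorted_words_def)

text \<open>A sorted word over an alphabet with largest letter \<open>b\<close> either avoids
  \<open>b\<close> or ends in it. This is the recursion of the complete homogeneous symmetric
  polynomials.\<close>

lemma sorted_words_insert_Suc:
  assumes "\<forall>k\<in>K. k < b"
  shows "sorted_words (insert b K) (Suc m) =
    sorted_words K (Suc m) \<union> (\<lambda>w. w @ [b]) ` sorted_words (insert b K) m" (is "?L = ?R")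
proof
  show "?L \<subseteq> ?R"
  proof
    fix w assume w: "w \<in> ?L"
    then have "w \<noteq> []" by (auto simp: sorted_words_def)
    then obtain u c where uc: "w = u @ [c]" by (metis rev_exhaust)
    then have u: "u \<in> sorted_words (insert b K) m" "c \<in> insert b K" "\<forall>x\<in>set u. x \<le> c"
      using w by (auto simp: sorted_words_def sorted_append)
    show "w \<in> ?R"
    proof (cases "c = b")
      case True
      then show ?thesis using u uc by blast
    next
      case False
      then have "b \<notin> set u" using u assms by (meson insertE not_le)
      then have "w \<in> sorted_words K (Suc m)" using w uc False by (auto simp: sorted_words_def)
      then show ?thesis by blast
    qed
  qed
  show "?R \<subseteq> ?L" using assms by (fastforce simp: sorted_words_def sorted_append subset_iff intro: less_imp_le)
qed

text \<open>The left-hand side is \<open>t\<^sup>m\<close> times the complete homogeneous symmetric polynomial of degree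
  \<open>m\<close> in the weights; the right-hand side is its generating function at \<open>t\<close>.\<close>

lemma sum_sorted_words_le:
  fixes v :: "nat \<Rightarrow> real"
  assumes "finite K" "t \<ge> 0" "\<And>k. k \<in> K \<Longrightarrow> 0 \<le> v k" "\<And>k. k \<in> K \<Longrightarrow> t * v k < 1"
  shows "t ^ m * (\<Sum>w\<in>sorted_words K m. \<Prod>a\<leftarrow>w. v a) \<le> (\<Prod>k\<in>K. 1 / (1 - t * v k))"
  using assms(1,3,4)
proof (induction K arbitrary: m rule: finite_linorder_max_induct)
  case empty
  have "sorted_words {} m = (if m = 0 then {[]} else {})" by (auto simp: sorted_words_def)
  then show ?case by simp
next
  case (insert b K)
  let ?S = "\<lambda>K m. \<Sum>w\<in>sorted_words K m. \<Prod>a\<leftarrow>w. v a"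
  define E where "E = (\<Prod>k\<in>K. 1 / (1 - t * v k))"
  have b: "b \<notin> K" using insert.hyps by auto
  have vb: "0 \<le> v b" "t * v b < 1" using insert.prems by auto
  have E: "(\<Prod>k\<in>insert b K. 1 / (1 - t * v k)) = E / (1 - t * v b)"
    using insert.hyps b by (simp add: E_def)
  have IH: "t ^ m * ?S K m \<le> E" for m
    unfolding E_def using insert by auto
  have "E \<ge> 0" unfolding E_def using insert.prems by (intro prod_nonneg) (auto intro: less_imp_le)
  \<comment> \<open>The outer induction adds the largest letter \<open>b\<close>; the inner one, on
    the degree, closes because \<open>E + q * (E / (1 - q)) = E / (1 - q)\<close> for
    \<open>q = t * v b\<close>.\<close>
  have "t ^ m * ?S (insert b K) m \<le> E / (1 - t * v b)" for m
  proof (induction m)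
    case 0
    have "1 \<le> E" using IH[of 0] by (simp add: sorted_words_0)
    also have "E \<le> E / (1 - t * v b)"
      using vb assms(2) \<open>E \<ge> 0\<close> by (simp add: le_divide_eq mult_left_le)
    finally show ?case by (simp add: sorted_words_0)
  next
    case (Suc m)
    have "?S (insert b K) (Suc m) = ?S K (Suc m) + (\<Sum>w\<in>(\<lambda>w. w @ [b]) ` sorted_words (insert b K) m. \<Prod>a\<leftarrow>w. v a)"
      using insert.hyps b unfolding sorted_words_insert_Suc[OF insert.hyps(2)]
      by (intro sum.union_disjoint finite_imageI finite_sorted_words finite.insertI)
         (auto simp: sorted_words_def)
    also have "(\<Sum>w\<in>(\<lambda>w. w @ [b]) ` sorted_words (insert b K) m. \<Prod>a\<leftarrow>w. v a) = ?S (insert b K) m * v b"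
      by (subst sum.reindex) (auto simp: inj_on_def sum_distrib_right)
    finally have "t ^ Suc m * ?S (insert b K) (Suc m) =
        t ^ Suc m * ?S K (Suc m) + (t * v b) * (t ^ m * ?S (insert b K) m)"
      by (simp add: algebra_simps)
    also have "\<dots> \<le> E + (t * v b) * (E / (1 - t * v b))"
      using IH[of "Suc m"] Suc vb assms(2) by (intro add_mono mult_left_mono) auto
    also have "\<dots> = E / (1 - t * v b)" using vb by (simp add: field_simps)
    finally show ?case .
  qed
  then show ?case using E by simp
qed

text \<open>The generating function is evaluated at 2. Weights of at most 1/4 bound each factor by
  \<open>exp (4 * v k)\<close>, and the weights sum to at most \<open>m / 8\<close>, so the product
  is at most \<open>exp (m / 2)\<close>; dividing by \<open>2 ^ m\<close> leaves the stated
  power.\<close>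

lemma sum_sorted_words_powr_le:
  fixes s \<beta> :: real
  assumes "finite K"
    and small: "\<And>k. k \<in> K \<Longrightarrow> real k powr (-(2 * s)) \<le> 1 / 4"
    and pos: "\<And>k. k \<in> K \<Longrightarrow> k > 0"
    and growth: "\<And>k. k \<in> K \<Longrightarrow> real k powr \<beta> \<le> real m"
    and tail: "(\<Sum>k\<in>K. real k powr (-(2 * s + \<beta>))) \<le> 1 / 8"
  shows "(\<Sum>w\<in>sorted_words K m. \<Prod>a\<leftarrow>w. real a powr (-(2 * s))) \<le> (exp (1/2) / 2) ^ m"
proof -
  define v where "v k = real k powr (-(2 * s))" for k
  have v: "0 \<le> v k" "v k \<le> 1/4" if "k \<in> K" for k
    using small[OF that] by (simp_all add: v_def)
  \<comment> \<open>The growth bound trades a factor \<open>m\<close> for a convergent exponent.\<close>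
  have "v k \<le> real m * real k powr (-(2 * s + \<beta>))" if "k \<in> K" for k
  proof -
    have "v k = real k powr \<beta> * real k powr (-(2 * s + \<beta>))"
      using pos[OF that] by (simp add: v_def flip: powr_add)
    then show ?thesis using growth[OF that] by (simp add: mult_right_mono)
  qed
  then have "sum v K \<le> real m * (\<Sum>k\<in>K. real k powr (-(2 * s + \<beta>)))"
    unfolding sum_distrib_left by (rule sum_mono)
  also have "\<dots> \<le> real m * (1 / 8)" using tail by (intro mult_left_mono) auto
  finally have sumv: "sum v K \<le> real m / 8" by simp
  have *: "1 / (1 - 2 * v k) \<le> exp (4 * v k)" if "k \<in> K" for k
  proof -
    have "1 / (1 - 2 * v k) \<le> 1 + 4 * v k"
    proof -
      \<comment> \<open>This product is one eighth of
        \<open>(1 + 4 * v k) * (1 - 2 * v k) - 1\<close>.\<close>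
      have "0 \<le> v k * (1/4 - v k)" using v[OF that] by (intro mult_nonneg_nonneg) auto
      then show ?thesis using v[OF that] by (simp add: divide_le_eq algebra_simps)
    qed
    also have "\<dots> \<le> exp (4 * v k)" by (rule exp_ge_add_one_self)
    finally show ?thesis .
  qed
  have v1: "2 * v k < 1" if "k \<in> K" for k using v[OF that] by simp
  have "2 ^ m * (\<Sum>w\<in>sorted_words K m. \<Prod>a\<leftarrow>w. v a) \<le> (\<Prod>k\<in>K. 1 / (1 - 2 * v k))"
    using assms(1) v(1) v1 by (intro sum_sorted_words_le) auto
  also have "\<dots> \<le> (\<Prod>k\<in>K. exp (4 * v k))"
  proof (intro prod_mono conjI)
    fix k assume "k \<in> K"
    then show "0 \<le> 1 / (1 - 2 * v k)" "1 / (1 - 2 * v k) \<le> exp (4 * v k)"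
      using v1[of k] *[of k] by auto
  qed
  also have "\<dots> = exp (4 * sum v K)"
    using assms(1) by (simp add: exp_sum sum_distrib_left)
  also have "\<dots> \<le> exp (real m * (1/2))" using sumv by simp
  also have "\<dots> = exp (1/2) ^ m" by (simp only: exp_of_nat_mult)
  finally show ?thesis
    by (simp add: v_def power_divide field_simps)
qed

text \<open>Letters start at an \<open>M\<close> beyond which every weight is at most 1/4 and the
  tail of the series with exponent \<open>2 * s + \<beta> > 1\<close> is below 1/8. Words of length
  \<open>m\<close> then contribute at most \<open>r ^ m\<close> with \<open>r < 1\<close>, which is
  summable over all lengths.\<close>

lemma summable_on_cf_words:
  fixes s \<beta> :: real
  assumes "s > 0" "2 * s + \<beta> > 1"
  obtains M :: nat where
    "(\<lambda>w. \<Prod>a\<leftarrow>w. real a powr (-(2 * s))) summable_on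
       {w. w \<in> sorted_words {k. M \<le> k \<and> real k powr \<beta> \<le> real (length w)} (length w)}"
proof -
  let ?f = "\<lambda>k::nat. real k powr (-(2 * s + \<beta>))"
  have "summable ?f" using assms(2) by (subst summable_real_powr_iff) simp
  then obtain M1 where M1: "\<And>m n. m \<ge> M1 \<Longrightarrow> norm (sum ?f {m..<n}) < 1/8"
    unfolding summable_Cauchy by (meson divide_pos_pos zero_less_numeral zero_less_one)
  have "((\<lambda>k::nat. real k powr (-(2 * s))) \<longlongrightarrow> 0) sequentially"
    using assms(1) by (intro tendsto_neg_powr filterlim_real_sequentially) auto
  then have "\<forall>\<^sub>F k in sequentially. real k powr (-(2 * s)) < 1/4"
    by (rule order_tendstoD) simp
  then obtain M2 where M2: "\<And>k. k \<ge> M2 \<Longrightarrow> real k powr (-(2 * s)) < 1/4"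
    by (auto simp: eventually_sequentially)
  define M where "M = max 1 (max M1 M2)"
  define P where "P w = (\<Prod>a\<leftarrow>w. real a powr (-(2 * s)))" for w :: "nat list"
  define W where "W = {w. w \<in> sorted_words {k. M \<le> k \<and> real k powr \<beta> \<le> real (length w)} (length w)}"
  define r :: real where "r = exp (1/2) / 2"
  \<comment> \<open>Here \<open>exp (1/2) \<le> 1 + 1/2 + 1/4 < 2\<close>.\<close>
  have r: "0 \<le> r" "r < 1" using exp_bound[of "1/2"] by (auto simp: r_def power2_eq_square)
  have P_nonneg: "P w \<ge> 0" for w by (simp add: P_def prod_list_real_nonneg)
  have level: "sum P {w \<in> F. length w = m} \<le> r ^ m" if F: "F \<subseteq> W" "finite F" for F m
  proof -
    \<comment> \<open>For \<open>\<beta> = 0\<close> the admissible alphabet can be infinite, so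
      only letters occurring in the finite set \<open>F\<close> are kept.\<close>
    define K where "K = {k. M \<le> k \<and> real k powr \<beta> \<le> real m} \<inter> \<Union> (set ` F)"
    have "finite K" using F by (auto simp: K_def)
    have "sum ?f K \<le> sum ?f {M..<Suc (Max (insert 0 K))}"
    proof (rule sum_mono2)
      have "k \<le> Max (insert 0 K)" if "k \<in> K" for k
        using \<open>finite K\<close> that by (intro Max_ge) auto
      moreover have "M \<le> k" if "k \<in> K" for k using that by (simp add: K_def)
      ultimately show "K \<subseteq> {M..<Suc (Max (insert 0 K))}" by (auto simp: less_Suc_eq_le)
    qed auto
    also have "\<dots> \<le> 1/8" using M1[of M "Suc (Max (insert 0 K))"] unfolding real_norm_def M_def by linarith
    finally have tail: "sum ?f K \<le> 1/8" .
    have "sum P {w \<in> F. length w = m} \<le> sum P (sorted_words K m)"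
      using F(1) \<open>finite K\<close> P_nonneg
      by (intro sum_mono2 finite_sorted_words) (auto simp: K_def W_def sorted_words_def)
    also have "\<dots> \<le> r ^ m"
      unfolding P_def r_def
      by (rule sum_sorted_words_powr_le[OF \<open>finite K\<close> _ _ _ tail])
         (use M2 in \<open>auto simp: K_def M_def intro: less_imp_le\<close>)
    finally show ?thesis .
  qed
  have "P summable_on W"
  proof (rule nonneg_bdd_above_summable_on)
    show "bdd_above (sum P ` {F. F \<subseteq> W \<and> finite F})"
    proof (rule bdd_aboveI2)
      fix F assume "F \<in> {F. F \<subseteq> W \<and> finite F}"
      then have F: "F \<subseteq> W" "finite F" by auto
      have "sum P F = (\<Sum>m\<in>length ` F. sum P {w \<in> F. length w = m})"
        using F(2) by (rule sum.image_gen)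
      also have "\<dots> \<le> (\<Sum>m\<in>length ` F. r ^ m)" by (intro sum_mono level F)
      also have "\<dots> \<le> (\<Sum>m. r ^ m)"
        using F r by (intro sum_le_suminf summable_geometric) auto
      finally show "sum P F \<le> (\<Sum>m. r ^ m)" .
    qed
  qed (rule P_nonneg)
  then show ?thesis using that[of M] unfolding P_def W_def by blast
qed

section \<open>Null sets of slowly growing quotients\<close>

text \<open>Cut the quotients of \<open>x\<close> at an index \<open>N\<close> beyond which all are
  at least \<open>M\<close>. The prefix \<open>p\<close> ranges over a countable set. By
  monotonicity the bound on the quotient \<open>N + m\<close> passes to the whole block of length
  \<open>m\<close> after \<open>p\<close>, so infinitely many \<open>m\<close> put \<open>x\<close>
  into infinitely many cylinders, and the Borel-Cantelli argument applies for each
  \<open>p\<close>.\<close>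

lemma hausdorff_measure_slow_growth_null:
  fixes s \<beta> :: real
  assumes "s > 0" "\<beta> \<ge> 0" "2 * s + \<beta> > 1"
  shows "hausdorff_measure s
    {x \<in> nondecreasing_cf_set. \<forall>N. \<exists>\<^sub>\<infinity>m. real (cf_quotient (N + m) x) powr \<beta> \<le> real m} = 0"
    (is "hausdorff_measure s ?A = 0")
proof -
  obtain M :: nat where M: "(\<lambda>w. \<Prod>a\<leftarrow>w. real a powr (-(2 * s))) summable_on
       {w. w \<in> sorted_words {k. M \<le> k \<and> real k powr \<beta> \<le> real (length w)} (length w)}"
    using summable_on_cf_words assms(1,3) by blast
  define W where "W = {w. w \<in> sorted_words {k. M \<le> k \<and> real k powr \<beta> \<le> real (length w)} (length w)}"
  define B where "B p = {x. infinite {w \<in> W. x \<in> cf_cylinder (p @ w)}}" for p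
  have "hausdorff_measure s (B p) = 0" for p
  proof (rule hausdorff_measure_limsup_null[OF assms(1)])
    show "(\<lambda>w. diam_weight s (cf_cylinder (p @ w))) summable_on W"
      by (rule summable_on_comparison_test[OF M[folded W_def]])
         (auto simp: diam_weight_nonneg intro: diam_weight_cf_cylinder[OF assms(1)])
  qed (auto simp: B_def bounded_cf_cylinder)
  moreover have "?A \<subseteq> (\<Union>p. B p)"
  proof
    fix x assume "x \<in> ?A"
    then have x: "x \<in> {0..<1}" "x \<notin> \<rat>" "mono_on {1..} (\<lambda>n. cf_quotient n x)"
      "filterlim (\<lambda>n. cf_quotient n x) at_top sequentially"
      and inf: "\<And>N. \<exists>\<^sub>\<infinity>m. real (cf_quotient (N + m) x) powr \<beta> \<le> real m"
      by (auto simp: nondecreasing_cf_set_def)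
    have x01: "x \<in> {0<..<1}" using x(1,2) by (cases "x = 0") auto
    obtain N where N: "\<And>n. n \<ge> N \<Longrightarrow> cf_quotient n x \<ge> M"
      using x(4) by (auto simp: filterlim_at_top eventually_sequentially)
    define q where "q i = cf_quotient (Suc i) x" for i
    have mono: "q i \<le> q j" if "i \<le> j" for i j
      using mono_onD[OF x(3), of "Suc i" "Suc j"] that by (simp add: q_def)
    define p where "p = map q [0..<N]"
    \<comment> \<open>As \<open>q\<close> counts from 0, this word consists of the quotients
      \<open>N + 1\<close> to \<open>N + m\<close>; its last letter is the one that the growth
      condition bounds.\<close>
    define u where "u m = map q [N..<N + m]" for m
    define S where "S = {m. real (cf_quotient (N + m) x) powr \<beta> \<le> real m} - {0}"
    have "infinite S" using inf[of N] by (simp add: S_def INFM_iff_infinite)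
    have "u ` S \<subseteq> {w \<in> W. x \<in> cf_cylinder (p @ w)}"
    proof safe
      fix m assume m: "m \<in> S"
      have "sorted (u m)"
        unfolding u_def by (intro sorted_map_mono) (auto simp: mono_on_def mono)
      moreover have "M \<le> q i \<and> real (q i) powr \<beta> \<le> real m" if "i \<in> {N..<N+m}" for i
      proof
        show "M \<le> q i" using N[of "Suc i"] that by (simp add: q_def)
        have "q i \<le> cf_quotient (N + m) x"
          using mono[of i "N + m - 1"] that by (cases "N + m") (auto simp: q_def)
        then have "real (q i) powr \<beta> \<le> real (cf_quotient (N + m) x) powr \<beta>"
          using assms(2) by (intro powr_mono2) auto
        then show "real (q i) powr \<beta> \<le> real m" using m by (simp add: S_def)
      qed
      ultimately show "u m \<in> W" by (auto simp: W_def sorted_words_def u_def)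
      have "p @ u m = map q [0..<N+m]" using upt_add_eq_append[of 0 N m] by (simp add: p_def u_def)
      then show "x \<in> cf_cylinder (p @ u m)" using x01 x(2)
        by (auto simp: cf_cylinder_def q_def simp del: upt_Suc)
    qed
    moreover have "inj_on u S"
      by (rule inj_onI, drule arg_cong[of _ _ length]) (simp add: u_def)
    ultimately have "infinite {w \<in> W. x \<in> cf_cylinder (p @ w)}"
      using \<open>infinite S\<close> by (meson finite_imageD finite_subset)
    then show "x \<in> (\<Union>p. B p)" by (auto simp: B_def)
  qed
  ultimately show ?thesis using hausdorff_measure_UN_null[OF assms(1), of B] by blast
qed

text \<open>Otherwise \<open>a\<^sub>N\<^sub>+\<^sub>m powr \<beta> > m\<close> for all large
  \<open>m\<close>. For \<open>t\<close> strictly between \<open>\<beta>\<close> and the exponent,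
  the terms with power \<open>-t\<close> are then dominated by
  \<open>m powr (-(t / \<beta>))\<close>, and the series converges at \<open>t\<close>, below the
  infimum.\<close>

lemma conv_exponent_slow_growth:
  assumes "ennreal \<beta> < conv_exponent x" "\<beta> > 0"
  shows "\<exists>\<^sub>\<infinity>m. real (cf_quotient (N + m) x) powr \<beta> \<le> real m"
proof (rule ccontr)
  assume "\<not> ?thesis"
  then obtain m0 where m0: "\<And>m. m \<ge> m0 \<Longrightarrow> real (cf_quotient (N + m) x) powr \<beta> > real m"
    by (auto simp: INFM_nat not_le intro: less_imp_le)
       (metis Suc_le_eq not_le)
  obtain s where s: "ennreal \<beta> < s" "s < conv_exponent x" using assms(1) dense by blast
  then obtain t where t: "s = ennreal t" "t \<ge> 0" by (cases s) (auto simp: top_unique)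
  have "t > \<beta>" using s(1) t assms(2) by (simp add: ennreal_less_iff)
  have "summable (\<lambda>n. real (cf_quotient (Suc (n + N)) x) powr (-t))"
  proof (rule summable_comparison_test_ev)
    show "summable (\<lambda>n. real (Suc n) powr (-(t / \<beta>)))"
      using \<open>t > \<beta>\<close> assms(2) summable_Suc_iff[of "\<lambda>n. real n powr (-(t / \<beta>))"]
      by (subst (asm) summable_real_powr_iff) simp
    have "norm (real (cf_quotient (Suc (n + N)) x) powr (-t)) \<le> real (Suc n) powr (-(t / \<beta>))"
      if "n \<ge> m0" for n
    proof -
      define c where "c = real (cf_quotient (Suc (n + N)) x)"
      have "real (Suc n) < c powr \<beta>"
        using m0[of "Suc n"] that by (simp add: c_def add.commute)
      then have "(c powr \<beta>) powr (-(t / \<beta>)) \<le> real (Suc n) powr (-(t / \<beta>))"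
        using assms(2) \<open>t > \<beta>\<close> by (intro powr_mono2') auto
      then show ?thesis using assms(2) by (simp add: powr_powr c_def)
    qed
    then show "\<forall>\<^sub>F n in sequentially. norm (real (cf_quotient (Suc (n + N)) x) powr (-t)) \<le> real (Suc n) powr (-(t / \<beta>))"
      unfolding eventually_sequentially by blast
  qed
  then have "summable (\<lambda>n. real (cf_quotient (Suc n) x) powr (-t))"
    by (subst (asm) summable_iff_shift)
  then have "conv_exponent x \<le> ennreal t"
    unfolding conv_exponent_def using t(2) by (intro INF_lower) auto
  then show False using s(2) t(1) by simp
qed

lemma hausdorff_measure_level_null:
  assumes "\<alpha> \<ge> 0" "s > 0" "s > (1 - \<alpha>) / 2"
  shows "hausdorff_measure s {x \<in> nondecreasing_cf_set. conv_exponent x = ennreal \<alpha>} = 0"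
proof -
  \<comment> \<open>For \<alpha> > 0 this is the midpoint of \<open>max 0 (1 - 2 * s)\<close> and
    \<alpha>, which are in strict order by the assumption on \<open>s\<close>. For \<alpha> = 0
    already \<open>2 * s > 1\<close>, and \<beta> = 0 makes the growth condition hold for every
    positive \<open>m\<close>.\<close>
  define \<beta> where "\<beta> = (if \<alpha> = 0 then 0 else (max 0 (1 - 2 * s) + \<alpha>) / 2)"
  have \<beta>: "\<beta> \<ge> 0" "2 * s + \<beta> > 1" "\<alpha> > 0 \<Longrightarrow> 0 < \<beta> \<and> \<beta> < \<alpha>"
    using assms by (auto simp: \<beta>_def max_def field_simps)
  have "\<exists>\<^sub>\<infinity>m. real (cf_quotient (N + m) x) powr \<beta> \<le> real m" if "conv_exponent x = ennreal \<alpha>" for x N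
  proof (cases "\<alpha> = 0")
    case True
    then have "real (cf_quotient (N + m) x) powr \<beta> \<le> real m" if "m > 0" for m
      using that by (simp add: \<beta>_def)
    then have "\<forall>\<^sub>\<infinity>m. real (cf_quotient (N + m) x) powr \<beta> \<le> real m"
      unfolding MOST_nat by (intro exI[of _ 0]) blast
    then show ?thesis by (rule MOST_INFM[rotated]) simp
  next
    case False
    then show ?thesis using that \<beta>(3) assms(1) by (intro conv_exponent_slow_growth) (auto simp: ennreal_less_iff)
  qed
  then have "{x \<in> nondecreasing_cf_set. conv_exponent x = ennreal \<alpha>} \<subseteq>
    {x \<in> nondecreasing_cf_set. \<forall>N. \<exists>\<^sub>\<infinity>m. real (cf_quotient (N + m) x) powr \<beta> \<le> real m}" by auto
  then show ?thesis
    using hausdorff_measure_UN_null[OF assms(2), of "\<lambda>_::unit. _"]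
      hausdorff_measure_slow_growth_null[OF assms(2) \<beta>(1,2)] by blast
qed

section \<open>Numbers with prescribed partial quotients\<close>

text \<open>The image of the closed unit interval under the first \<open>n\<close> inverse branches.
  Unlike the cylinders of irrational points it is compact, so nested intersections are
  non-empty.\<close>

primrec cf_nest :: "nat \<Rightarrow> (nat \<Rightarrow> nat) \<Rightarrow> real set" where
  "cf_nest 0 a = {0..1}"
| "cf_nest (Suc n) a = (\<lambda>t. 1 / (real (a 0) + t)) ` cf_nest n (a \<circ> Suc)"

lemma cf_nest_subset: "(\<And>i. a i \<ge> 1) \<Longrightarrow> cf_nest n a \<subseteq> {0..1}"
proof (induction n arbitrary: a)
  case (Suc n)
  have "cf_nest n (a \<circ> Suc) \<subseteq> {0..1}" using Suc.prems by (intro Suc.IH) simp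
  moreover have "real (a 0) \<ge> 1" using Suc.prems by simp
  ultimately show ?case by (fastforce simp: divide_le_eq_1)
qed simp

lemma compact_cf_nest: "(\<And>i. a i \<ge> 1) \<Longrightarrow> compact (cf_nest n a)"
proof (induction n arbitrary: a)
  case (Suc n)
  have "cf_nest n (a \<circ> Suc) \<subseteq> {0..1}" using Suc.prems by (intro cf_nest_subset) simp
  moreover have "real (a 0) \<ge> 1" using Suc.prems by simp
  ultimately have "continuous_on (cf_nest n (a \<circ> Suc)) (\<lambda>t. 1 / (real (a 0) + t))"
    by (intro continuous_intros) force
  then show ?case using Suc by (simp add: compact_continuous_image)
qed simp

lemma cf_nest_nonempty: "cf_nest n a \<noteq> {}"
  by (induction n arbitrary: a) auto

lemma cf_nest_decseq:
  assumes "\<And>i. a i \<ge> 1" "m \<le> n"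
  shows "cf_nest n a \<subseteq> cf_nest m a"
proof -
  have "cf_nest (Suc n) a \<subseteq> cf_nest n a" if "\<And>i. a i \<ge> 1" for n
    using that
  proof (induction n arbitrary: a)
    case 0
    then show ?case using cf_nest_subset[of a "Suc 0"] by simp
  next
    case (Suc n)
    have "cf_nest (Suc n) (a \<circ> Suc) \<subseteq> cf_nest n (a \<circ> Suc)" using Suc.prems by (intro Suc.IH) simp
    then show ?case by (subst (1 2) cf_nest.simps(2)) (rule image_mono)
  qed
  then show ?thesis using lift_Suc_antimono_le[of "\<lambda>n. cf_nest n a"] assms by blast
qed

definition cf_limit_set :: "(nat \<Rightarrow> nat) \<Rightarrow> real set" where
  "cf_limit_set a = (\<Inter>n. cf_nest n a)"

lemma cf_limit_set_nonempty: "(\<And>i. a i \<ge> 1) \<Longrightarrow> cf_limit_set a \<noteq> {}"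
  unfolding cf_limit_set_def
  by (intro compact_nest compact_cf_nest cf_nest_nonempty cf_nest_decseq)

text \<open>The branch is injective on non-negative numbers, so the preimage of \<open>x\<close> is
  the same at every depth and lies in the whole intersection.\<close>

lemma cf_limit_set_step:
  assumes a: "\<And>i. a i \<ge> 1" and x: "x \<in> cf_limit_set a"
  obtains t where "t \<in> cf_limit_set (a \<circ> Suc)" "x = 1 / (real (a 0) + t)" "t \<ge> 0"
proof
  define t where "t = 1 / x - real (a 0)"
  have *: "t \<in> cf_nest n (a \<circ> Suc)" "x = 1 / (real (a 0) + t)" "t \<ge> 0" for n
  proof -
    have "x \<in> cf_nest (Suc n) a" using x unfolding cf_limit_set_def by blast
    then obtain t' where t': "t' \<in> cf_nest n (a \<circ> Suc)" "x = 1 / (real (a 0) + t')" by auto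
    have "cf_nest n (a \<circ> Suc) \<subseteq> {0..1}" using a by (intro cf_nest_subset) simp
    with t' have "t' \<ge> 0" by auto
    moreover have "t' = t" using t'(2) \<open>t' \<ge> 0\<close> a[of 0] by (simp add: t_def)
    ultimately show "t \<in> cf_nest n (a \<circ> Suc)" "x = 1 / (real (a 0) + t)" "t \<ge> 0"
      using t' by auto
  qed
  then show "t \<in> cf_limit_set (a \<circ> Suc)" "x = 1 / (real (a 0) + t)" "t \<ge> 0"
    by (auto simp: cf_limit_set_def)
qed

lemma cf_limit_set_pos: "(\<And>i. a i \<ge> 1) \<Longrightarrow> x \<in> cf_limit_set a \<Longrightarrow> x > 0"
  by (erule cf_limit_set_step[rotated]) (auto simp: add_pos_nonneg Suc_le_eq)

lemma cf_limit_set_gauss_map: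
  assumes a: "\<And>i. a i \<ge> 1" and x: "x \<in> cf_limit_set a"
  shows "x \<in> {0<..<1}" "gauss_map x \<in> cf_limit_set (a \<circ> Suc)" "nat \<lfloor>1 / x\<rfloor> = a 0"
    "gauss_map x = 1 / x - real (a 0)"
proof -
  \<comment> \<open>The compact sets may contain 0 and 1. Going one level deeper excludes both,
    which makes \<open>t\<close> the true fractional part of \<open>1 / x\<close>.\<close>
  have less_1: "y \<in> {0<..<1}" if b: "\<And>i. b i \<ge> 1" and y: "y \<in> cf_limit_set b" for b y
  proof -
    obtain t where t: "t \<in> cf_limit_set (b \<circ> Suc)" "y = 1 / (real (b 0) + t)" "t \<ge> 0"
      by (rule cf_limit_set_step[OF b y])
    have "t > 0" using b by (intro cf_limit_set_pos[OF _ t(1)]) simp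
    moreover have "real (b 0) \<ge> 1" using b by simp
    ultimately show ?thesis using t(2) by auto
  qed
  obtain t where t: "t \<in> cf_limit_set (a \<circ> Suc)" "x = 1 / (real (a 0) + t)" "t \<ge> 0"
    by (rule cf_limit_set_step[OF a x])
  have t01: "t \<in> {0<..<1}" using a by (intro less_1[OF _ t(1)]) simp
  then have fl: "\<lfloor>1 / x\<rfloor> = int (a 0)" using t(2) by (simp add: floor_eq_iff)
  have "gauss_map x = t" using t(2) t01 by (simp add: gauss_map_def frac_def floor_eq_iff)
  then show "gauss_map x \<in> cf_limit_set (a \<circ> Suc)" "gauss_map x = 1 / x - real (a 0)"
    using t by auto
  show "x \<in> {0<..<1}" "nat \<lfloor>1 / x\<rfloor> = a 0" using less_1[OF a x] fl by auto
qed

lemma cf_quotient_cf_limit_set: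
  assumes "\<And>i. a i \<ge> 1" "x \<in> cf_limit_set a"
  shows "cf_quotient (Suc n) x = a n"
  using assms
proof (induction n arbitrary: a x)
  case 0
  then show ?case using cf_limit_set_gauss_map(3)[of a x] by (simp add: cf_quotient_def)
next
  case (Suc n)
  have "cf_quotient (Suc n) (gauss_map x) = (a \<circ> Suc) n"
    using Suc.prems cf_limit_set_gauss_map(2)[of a x] Suc.IH[of "a \<circ> Suc" "gauss_map x"]
    by (simp add: comp_def)
  then show ?case by (simp add: cf_quotient_gauss_map)
qed

text \<open>The Gauss map strictly decreases the numerator of a fraction.\<close>

lemma cf_limit_set_not_fraction:
  assumes "\<And>i. a i \<ge> 1" "x \<in> cf_limit_set a" "q > 0"
  shows "x \<noteq> real p / real q"
  using assms
proof (induction p arbitrary: a x q rule: less_induct)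
  case (less p)
  show ?case
  proof
    assume eq: "x = real p / real q"
    note x = cf_limit_set_gauss_map[OF less.prems(1,2)]
    note y = cf_limit_set_gauss_map[of "a \<circ> Suc", OF _ x(2)]
    have "p > 0" using x(1) eq by (cases "p = 0") auto
    have g: "gauss_map x = (real q - real (a 0 * p)) / real p"
      unfolding x(4) unfolding eq using \<open>p > 0\<close> less.prems(3) by (simp add: field_simps)
    have g01: "0 < gauss_map x" "gauss_map x < 1" using y(1) less.prems(1) by auto
    then have "real (a 0 * p) < real q" "real q - real (a 0 * p) < real p"
      using \<open>p > 0\<close> unfolding g by (simp_all add: field_simps)
    then have "a 0 * p < q" "q - a 0 * p < p" by linarith+
    moreover from this have "gauss_map x = real (q - a 0 * p) / real p"
      unfolding g by (simp add: of_nat_diff)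
    ultimately show False
      using less.IH[of "q - a 0 * p" "a \<circ> Suc" "gauss_map x" p] less.prems(1) x(2) \<open>p > 0\<close>
      by (simp add: comp_def)
  qed
qed

lemma ex_irrational_cf_quotients:
  assumes "\<And>i. a i \<ge> 1"
  shows "\<exists>x\<in>{0<..<1}. x \<notin> \<rat> \<and> (\<forall>i. cf_quotient (Suc i) x = a i)"
proof -
  obtain x where x: "x \<in> cf_limit_set a" using cf_limit_set_nonempty[of a] assms by auto
  have x01: "x \<in> {0<..<1}" using cf_limit_set_gauss_map(1)[of a x] assms x by blast
  have "x \<notin> \<rat>"
  proof
    assume "x \<in> \<rat>"
    then obtain m n :: nat where "n \<noteq> 0" "\<bar>x\<bar> = real m / real n" by (rule Rats_abs_nat_div_natE)
    then show False using cf_limit_set_not_fraction[of a x n m] assms x x01 by auto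
  qed
  then show ?thesis using x01 cf_quotient_cf_limit_set[of a x] assms x by blast
qed

section \<open>Separation of points with different quotients\<close>

text \<open>A lower counterpart of the cylinder estimate. An inverse branch shrinks distances by at
  most the factor \<open>(h i)\<^sup>2\<close>, since the integer \<open>h i\<close> exceeds the
  quotient and hence also the quotient plus its remainder. The condition on the quotient after the
  separating one keeps neighbouring cylinders apart.\<close>

lemma cf_dist_lower:
  fixes h :: "nat \<Rightarrow> nat"
  assumes "x \<in> {0<..<1}" "x \<notin> \<rat>" "y \<in> {0<..<1}" "y \<notin> \<rat>"
    and "\<And>i. i < n \<Longrightarrow> cf_quotient (Suc i) x = cf_quotient (Suc i) y"
    and "\<And>i. i \<le> n \<Longrightarrow> cf_quotient (Suc i) x < h i" "\<And>i. i \<le> n \<Longrightarrow> cf_quotient (Suc i) y < h i"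
    and "cf_quotient (Suc (Suc n)) x \<ge> 2" "cf_quotient (Suc (Suc n)) y \<ge> 2"
  shows "\<bar>real (cf_quotient (Suc n) x) - real (cf_quotient (Suc n) y)\<bar>
    \<le> 2 * (\<Prod>i\<le>n. (real (h i))\<^sup>2) * \<bar>x - y\<bar>"
  using assms
proof (induction n arbitrary: x y h)
  case (0 x y h)
  define a b u v where "a = cf_quotient 1 x" and "b = cf_quotient 1 y"
    and "u = gauss_map x" and "v = gauss_map y"
  have half: "gauss_map z \<in> {0<..1/2}" if "z \<notin> \<rat>" "cf_quotient (Suc (Suc 0)) z \<ge> 2" for z
  proof -
    note z = gauss_map_irrational[OF that(1)]
    have "gauss_map z = 1 / (real (cf_quotient 1 (gauss_map z)) + gauss_map (gauss_map z))"
      using cf_quotient_unfold(1)[OF z(2)] .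
    also have "\<dots> \<le> 1 / 2"
      using that(2) gauss_map_irrational[OF z(1)] by (intro divide_left_mono) (auto simp: cf_quotient_gauss_map)
    finally show ?thesis using z by auto
  qed
  have uv: "u \<in> {0<..1/2}" "v \<in> {0<..1/2}" using half 0 by (auto simp: u_def v_def)
  have x: "x = 1 / (real a + u)" "a \<ge> 1" and y: "y = 1 / (real b + v)" "b \<ge> 1"
    using cf_quotient_unfold[OF 0(1)] cf_quotient_unfold[OF 0(3)] by (auto simp: a_def b_def u_def v_def)
  have ah: "real a + 1 \<le> real (h 0)" "real b + 1 \<le> real (h 0)"
    using 0(6)[of 0] 0(7)[of 0] by (auto simp: a_def b_def)
  define D where "D = (real a + u) * (real b + v)"
  have D: "0 < D" "D \<le> (real (h 0))\<^sup>2"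
    using uv ah unfolding D_def power2_eq_square by (auto intro!: mult_mono mult_pos_pos)
  \<comment> \<open>The remainders lie in \<open>{0<..1/2}\<close>, so they change the distance of
    distinct integers by less than 1/2, hence by at most half of it.\<close>
  have "\<bar>real a - real b\<bar> \<le> 2 * \<bar>(real b + v) - (real a + u)\<bar>"
  proof (cases "a = b")
    case False
    then have "1 \<le> \<bar>real a - real b\<bar>" by linarith
    then show ?thesis using uv by (cases "a < b") (auto simp: abs_if field_simps)
  qed simp
  also have "\<bar>(real b + v) - (real a + u)\<bar> = D * \<bar>x - y\<bar>"
    using inverse_shift_diff[of a u b v] uv D x y by (simp add: D_def)
  also have "\<dots> \<le> (real (h 0))\<^sup>2 * \<bar>x - y\<bar>" using D by (intro mult_right_mono) auto
  finally show ?case by (simp add: a_def b_def)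
next
  case (Suc n x y h)
  define a u v where "a = cf_quotient 1 x" and "u = gauss_map x" and "v = gauss_map y"
  have x: "x = 1 / (real a + u)" "a \<ge> 1" and y: "y = 1 / (real a + v)"
    using cf_quotient_unfold[OF Suc.prems(1)] cf_quotient_unfold[OF Suc.prems(3)] Suc.prems(5)[of 0]
    by (auto simp: a_def u_def v_def)
  have u: "u \<notin> \<rat>" "u \<in> {0<..<1}" and v: "v \<notin> \<rat>" "v \<in> {0<..<1}"
    using gauss_map_irrational Suc.prems(2,4) by (auto simp: u_def v_def)
  have cf: "cf_quotient (Suc i) u = cf_quotient (Suc (Suc i)) x"
    "cf_quotient (Suc i) v = cf_quotient (Suc (Suc i)) y" for i
    by (simp_all add: u_def v_def cf_quotient_gauss_map)
  have ah: "real a + 1 \<le> real (h 0)" using Suc.prems(6)[of 0] by (auto simp: a_def)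
  define D where "D = (real a + u) * (real a + v)"
  have D: "0 < D" "D \<le> (real (h 0))\<^sup>2"
    using u v ah unfolding D_def power2_eq_square by (auto intro!: mult_mono mult_pos_pos add_nonneg_pos)
  have "\<bar>real (cf_quotient (Suc n) u) - real (cf_quotient (Suc n) v)\<bar>
      \<le> 2 * (\<Prod>i\<le>n. (real (h (Suc i)))\<^sup>2) * \<bar>u - v\<bar>"
    using Suc.prems by (intro Suc.IH u v) (auto simp: cf)
  also have "\<dots> \<le> 2 * (\<Prod>i\<le>n. (real (h (Suc i)))\<^sup>2) * ((real (h 0))\<^sup>2 * \<bar>x - y\<bar>)"
  proof (rule mult_left_mono)
    have "\<bar>u - v\<bar> = D * \<bar>x - y\<bar>"
      using inverse_shift_diff[of a u a v] u v D x y by (simp add: D_def abs_minus_commute)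
    also have "\<dots> \<le> (real (h 0))\<^sup>2 * \<bar>x - y\<bar>" using D by (intro mult_right_mono) auto
    finally show "\<bar>u - v\<bar> \<le> (real (h 0))\<^sup>2 * \<bar>x - y\<bar>" .
  qed (simp add: prod_nonneg)
  finally show ?case
    by (simp add: cf prod.atMost_Suc_shift mult_ac del: prod.atMost_Suc)
qed

section \<open>Lower bound\<close>

text \<open>A set \<open>D\<close> of values at coordinate \<open>n\<close> is allowed because a
  covering set can meet several cylinders that branch at the same depth.\<close>

lemma emeasure_PiM_uniform_cylinder:
  fixes A :: "nat \<Rightarrow> 'a set"
  assumes A: "\<And>i. finite (A i)" "\<And>i. A i \<noteq> {}"
    and w: "\<And>i. w i \<in> A i" and D: "D \<subseteq> A n"
  defines "M \<equiv> \<lambda>i. uniform_count_measure (A i)"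
  defines "T \<equiv> Pi\<^sub>E UNIV (\<lambda>i. if i < n then {w i} else if i = n then D else A i)"
  shows "T \<in> sets (Pi\<^sub>M UNIV M)"
    and "emeasure (Pi\<^sub>M UNIV M) T = ennreal ((\<Prod>i<n. 1 / card (A i)) * (card D / card (A n)))"
proof -
  define Y where "Y i = (if i < n then {w i} else if i = n then D else A i)" for i
  interpret prob_space "M i" for i
    using A by (auto simp: M_def intro!: prob_space_uniform_count_measure)
  interpret product_prob_space M UNIV ..
  have Y: "Y i \<subseteq> A i" for i using w D by (auto simp: Y_def)
  have space: "space (M i) = A i" "sets (M i) = Pow (A i)" for i
    by (simp_all add: M_def space_uniform_count_measure sets_uniform_count_measure)
  have T: "T = Pi\<^sub>E UNIV Y" by (simp add: T_def Y_def[abs_def])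
  show "T \<in> sets (Pi\<^sub>M UNIV M)"
    unfolding T using Y by (intro sets_PiM_I_countable) (auto simp: space)
  \<comment> \<open>Beyond \<open>n\<close> there is no restriction, so the infinite product set is
    a cylinder over \<open>{..n}\<close> and has the finite product as its measure.\<close>
  have "(\<forall>i. x i \<in> Y i) \<longleftrightarrow> (\<forall>i. x i \<in> A i) \<and> (\<forall>i\<in>{..n}. x i \<in> Y i)" for x
  proof -
    have "Y i = A i" if "\<not> i \<le> n" for i using that by (simp add: Y_def)
    then show ?thesis using Y by (metis atMost_iff subsetD)
  qed
  then have "T = prod_emb UNIV M {..n} (Pi\<^sub>E {..n} Y)"
    unfolding T by (intro set_eqI) (simp add: prod_emb_def PiE_iff space conj_commute)
  then have "emeasure (Pi\<^sub>M UNIV M) T = (\<Prod>i\<le>n. emeasure (M i) (Y i))"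
    using Y by (simp add: emeasure_PiM_emb space)
  also have "\<dots> = (\<Prod>i\<le>n. ennreal (card (Y i) / card (A i)))"
    using Y A by (simp add: M_def emeasure_uniform_count_measure divide_ennreal ennreal_of_nat_eq_real_of_nat)
  also have "\<dots> = ennreal (\<Prod>i\<le>n. card (Y i) / card (A i))"
    by (intro prod_ennreal) auto
  also have "(\<Prod>i\<le>n. card (Y i) / card (A i)) = (\<Prod>i<n. 1 / card (A i)) * (card D / card (A n))"
    unfolding lessThan_Suc_atMost[symmetric] by (simp add: Y_def)
  finally show "emeasure (Pi\<^sub>M UNIV M) T = ennreal ((\<Prod>i<n. 1 / card (A i)) * (card D / card (A n)))" .
qed

text \<open>The preimage of \<open>U\<close> is enclosed in a product set, so \<open>X\<close> need not be measurable.\<close>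

lemma cf_cylinder_mass_le:
  fixes g :: "nat \<Rightarrow> nat" and C s :: real and X :: "(nat \<Rightarrow> nat) \<Rightarrow> real"
  defines "A \<equiv> \<lambda>i. {g i..<g (Suc i)}"
  defines "P \<equiv> Pi\<^sub>M UNIV (\<lambda>i. uniform_count_measure (A i))"
  assumes g: "\<And>n. g n + 2 \<le> g (Suc n)" "g 0 \<ge> 2" and s: "0 \<le> s" "s \<le> 1"
    and C: "\<And>n. (\<Prod>i<n. (real (g (Suc i)))\<^sup>2 powr s / real (g (Suc i) - g i)) *
        ((real (g (Suc n)))\<^sup>2 / real (g (Suc n) - g n)) powr s \<le> C"
    and X: "\<And>w. w \<in> Pi\<^sub>E UNIV A \<Longrightarrow> X w \<in> {0<..<1} \<and> X w \<notin> \<rat> \<and> (\<forall>i. cf_quotient (Suc i) (X w) = w i)"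
    and U: "bounded U"
  shows "\<exists>T\<in>sets P. {w \<in> Pi\<^sub>E UNIV A. X w \<in> U} \<subseteq> T \<and> emeasure P T \<le> ennreal (4 powr s * C * diam_weight s U)"
proof -
  define S where "S = {w \<in> Pi\<^sub>E UNIV A. X w \<in> U}"
  define N where "N i = g (Suc i) - g i" for i
  have A: "finite (A i)" "A i \<noteq> {}" "card (A i) = N i" "N i \<ge> 2" for i
    using g(1)[of i] by (auto simp: A_def N_def)
  have g2: "g i \<ge> 2" for i
  proof (induction i)
    case (Suc i)
    then show ?case using g(1)[of i] by simp
  qed (rule g(2))
  have S: "w \<in> Pi\<^sub>E UNIV A" "\<And>i. w i \<in> A i" "X w \<in> U" "X w \<in> {0<..<1}" "X w \<notin> \<rat>" "\<And>i. cf_quotient (Suc i) (X w) = w i"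
    if "w \<in> S" for w
    using that X[of w] by (auto simp: S_def PiE_iff)
  note cyl = emeasure_PiM_uniform_cylinder[of A, OF A(1,2), folded P_def]
  \<comment> \<open>Either \<open>S\<close> has at most one sequence and mass 0, or there is a first
    coordinate \<open>n\<close> at which its sequences differ.\<close>
  show ?thesis
  proof (cases "\<exists>n. \<exists>w\<in>S. \<exists>w'\<in>S. w n \<noteq> w' n")
    case False
    have "\<exists>T\<in>sets P. S \<subseteq> T \<and> emeasure P T \<le> 0"
    proof (cases "S = {}")
      case True
      then show ?thesis by (intro bexI[of _ "{}"]) auto
    next
      case nonempty: False
      then obtain w where w: "w \<in> S" by blast
      have "{w} = Pi\<^sub>E UNIV (\<lambda>i. {w i})" by (auto simp: PiE_iff)
      then have meas: "{w} \<in> sets P"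
        unfolding P_def using S(2)[OF w]
        by (auto intro!: sets_PiM_I_countable simp: sets_uniform_count_measure)
      \<comment> \<open>Every block has at least two values, so fixing \<open>n\<close> coordinates
        leaves mass at most \<open>(1/2) ^ n\<close>.\<close>
      have "emeasure P {w} \<le> ennreal ((1/2) ^ n)" for n
      proof -
        have "emeasure P {w} \<le> emeasure P (Pi\<^sub>E UNIV (\<lambda>i. if i < n then {w i} else if i = n then A n else A i))"
          using S(2)[OF w] cyl(1)[of w "A n" n] by (intro emeasure_mono) (auto simp: PiE_iff)
        also have "\<dots> = ennreal ((\<Prod>i<n. 1 / N i) * (card (A n) / N n))"
          using S(2)[OF w] by (subst cyl(2)) (auto simp: A(3))
        also have "\<dots> = ennreal (\<Prod>i<n. 1 / N i)" using A(3,4)[of n] by simp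
        also have "\<dots> \<le> ennreal (\<Prod>i<n. 1 / 2)"
          using A(4) by (intro ennreal_leI prod_mono conjI frac_le) auto
        finally show ?thesis by simp
      qed
      moreover have "(\<lambda>n. ennreal ((1/2) ^ n)) \<longlonglongrightarrow> ennreal 0"
        by (intro tendsto_ennrealI LIMSEQ_power_zero) simp
      ultimately have "emeasure P {w} \<le> 0"
        by (intro LIMSEQ_le_const[where x = 0]) (auto simp: ennreal_0)
      moreover have "S \<subseteq> {w}" using False w by auto
      ultimately show ?thesis using meas by blast
    qed
    then show ?thesis unfolding S_def by (meson order_trans zero_le)
  next
    case True
    define n where "n = (LEAST n. \<exists>w\<in>S. \<exists>w'\<in>S. w n \<noteq> w' n)"
    have n: "\<exists>w\<in>S. \<exists>w'\<in>S. w n \<noteq> w' n" unfolding n_def by (rule LeastI_ex[OF True])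
    have before: "w i = w' i" if "w \<in> S" "w' \<in> S" "i < n" for w w' i
      using not_less_Least that unfolding n_def by blast
    obtain w where w: "w \<in> S" using n by blast
    define D where "D = (\<lambda>w. w n) ` S"
    have D: "D \<subseteq> A n" using S(2) by (auto simp: D_def)
    have fin: "finite D" using D A(1) finite_subset by blast
    define T where "T = Pi\<^sub>E UNIV (\<lambda>i. if i < n then {w i} else if i = n then D else A i)"
    have T: "T \<in> sets P" "emeasure P T = ennreal ((\<Prod>i<n. 1 / N i) * (card D / N n))"
      unfolding T_def using cyl[OF S(2)[OF w] D] by (simp_all add: A(3))
    have "S \<subseteq> T"
      using before[OF _ w] S(2) by (auto simp: T_def PiE_iff D_def)
    have "D \<noteq> {}" using w by (auto simp: D_def)
    \<comment> \<open>The extreme values of \<open>D\<close> are compared: \<open>card D\<close> is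
      at most \<open>Max D - Min D + 1\<close>, hence at most twice the difference, which the
      separation estimate bounds in terms of the diameter of \<open>U\<close>.\<close>
    then obtain w1 w2 where w12: "w1 \<in> S" "w2 \<in> S" "w1 n = Min D" "w2 n = Max D"
      using Min_in[OF fin] Max_in[OF fin] unfolding D_def by fastforce
    have "Min D < Max D"
    proof -
      obtain u v where "u \<in> S" "v \<in> S" "u n \<noteq> v n" using n by blast
      then have "u n \<in> D" "v n \<in> D" by (auto simp: D_def)
      then show ?thesis
        using Min_le[OF fin] Max_ge[OF fin] \<open>u n \<noteq> v n\<close> by (metis le_antisym not_le order_trans)
    qed
    have "card D \<le> card {Min D..Max D}"
      using Min_le[OF fin] Max_ge[OF fin] by (intro card_mono) auto
    then have cardD: "real (card D) \<le> 2 * \<bar>real (w1 n) - real (w2 n)\<bar>"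
      using \<open>Min D < Max D\<close> by (simp add: w12)
    define d where "d = diameter U"
    define Q where "Q = (\<Prod>i<n. (real (g (Suc i)))\<^sup>2)"
    have "Q \<ge> 0" by (simp add: Q_def prod_nonneg)
    define z where "z = (real (g (Suc n)))\<^sup>2 / real (N n)"
    have "z \<ge> 0" by (simp add: z_def)
    have "\<bar>X w1 - X w2\<bar> \<le> d"
      using diameter_bounded_bound[OF U S(3)[OF w12(1)] S(3)[OF w12(2)]] by (simp add: d_def dist_real_def)
    moreover have "\<bar>real (w1 n) - real (w2 n)\<bar> \<le> 2 * (\<Prod>i\<le>n. (real (g (Suc i)))\<^sup>2) * \<bar>X w1 - X w2\<bar>"
    proof -
      have lt: "w i < g (Suc i)" "w i \<ge> 2" if "w \<in> S" for w i
        using S(2)[OF that, of i] g2[of i] by (auto simp: A_def)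
      show ?thesis
        using cf_dist_lower[of "X w1" "X w2" n "\<lambda>i. g (Suc i)"] w12 lt S(4-6) before by simp
    qed
    ultimately have "real (card D) \<le> 2 * (2 * (\<Prod>i\<le>n. (real (g (Suc i)))\<^sup>2) * d)"
      using cardD by (smt (verit) mult_left_mono prod_nonneg zero_le_power2)
    then have cardD': "real (card D) \<le> 4 * (Q * (real (g (Suc n)))\<^sup>2 * d)"
      by (simp add: Q_def flip: lessThan_Suc_atMost)
    have "card D > 0" using fin \<open>D \<noteq> {}\<close> by (simp add: card_gt_0_iff)
    then have "d \<noteq> 0" using cardD' by auto
    then have "d > 0" using diameter_ge_0[OF U] by (simp add: d_def)
    have "U \<noteq> {}" using S(3)[OF w] by auto
    \<comment> \<open>A nonzero diameter makes this valid for \<open>s = 0\<close> too, where both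
      sides are 1.\<close>
    have weight: "diam_weight s U = d powr s"
      using \<open>U \<noteq> {}\<close> \<open>d \<noteq> 0\<close> by (simp add: diam_weight_def d_def)
    define y where "y = real (card D) / real (N n)"
    have "card D \<le> N n" using card_mono[OF A(1) D] by (simp add: A(3))
    then have y: "0 \<le> y" "y \<le> 1" using A(4)[of n] by (auto simp: y_def)
    \<comment> \<open>The proportion \<open>y\<close> of the block that is hit is at most 1. Passing
      to its power \<open>s \<le> 1\<close> turns the bound that is linear in \<open>d\<close> into
      one in \<open>d powr s\<close>.\<close>
    have "y \<le> y powr s" using powr_mono'[OF s(2) y] y by simp
    also have "\<dots> \<le> (4 * (Q * (real (g (Suc n)))\<^sup>2 * d) / real (N n)) powr s"
      unfolding y_def using cardD' s by (intro powr_mono2 divide_right_mono) auto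
    also have "4 * (Q * (real (g (Suc n)))\<^sup>2 * d) / real (N n) = 4 * (Q * (z * d))"
      by (simp add: z_def)
    also have "\<dots> powr s = 4 powr s * (Q powr s * (z powr s * d powr s))"
      using \<open>Q \<ge> 0\<close> \<open>d > 0\<close> \<open>z \<ge> 0\<close> by (simp add: powr_mult)
    finally have "(\<Prod>i<n. 1 / N i) * y \<le> (\<Prod>i<n. 1 / N i) * (4 powr s * (Q powr s * (z powr s * d powr s)))"
      by (intro mult_left_mono prod_nonneg) auto
    also have "\<dots> = 4 powr s * (((\<Prod>i<n. 1 / N i) * Q powr s) * z powr s) * d powr s"
      by (simp only: mult_ac)
    also have "(\<Prod>i<n. 1 / N i) * Q powr s = (\<Prod>i<n. (real (g (Suc i)))\<^sup>2 powr s / real (N i))"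
      unfolding Q_def by (simp add: prod_powr_distrib prod_dividef)
    also have "4 powr s * (\<dots> * z powr s) * d powr s \<le> 4 powr s * C * d powr s"
      using C[of n] by (intro mult_right_mono mult_left_mono) (auto simp: N_def z_def)
    finally have "emeasure P T \<le> ennreal (4 powr s * C * diam_weight s U)"
      unfolding T(2) weight by (simp add: y_def ennreal_leI)
    then show ?thesis using T(1) \<open>S \<subseteq> T\<close> unfolding S_def by blast
  qed
qed

text \<open>The mass distribution principle. In the hypothesis on \<open>C\<close> the product
  compares the mass of a cylinder of depth \<open>n\<close> with the power \<open>s\<close> of its
  size, and the last factor accounts for sets that meet several of its children.\<close>

lemma hausdorff_measure_cf_cantor_pos:
  fixes g :: "nat \<Rightarrow> nat" and C s :: real
  assumes g: "\<And>n. g n + 2 \<le> g (Suc n)" "g 0 \<ge> 2" and s: "0 \<le> s" "s \<le> 1"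
    and C: "\<And>n. (\<Prod>i<n. (real (g (Suc i)))\<^sup>2 powr s / real (g (Suc i) - g i)) *
        ((real (g (Suc n)))\<^sup>2 / real (g (Suc n) - g n)) powr s \<le> C"
    and E: "\<And>x. x \<in> {0<..<1} \<Longrightarrow> x \<notin> \<rat> \<Longrightarrow> (\<And>i. cf_quotient (Suc i) x \<in> {g i..<g (Suc i)}) \<Longrightarrow> x \<in> E"
  shows "hausdorff_measure s E \<noteq> 0"
proof
  assume null: "hausdorff_measure s E = 0"
  define A where "A i = {g i..<g (Suc i)}" for i
  define P where "P = Pi\<^sub>M UNIV (\<lambda>i. uniform_count_measure (A i))"
  have g2: "g i \<ge> 2" for i
  proof (induction i)
    case (Suc i)
    then show ?case using g(1)[of i] by simp
  qed (rule g(2))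
  have A: "finite (A i)" "A i \<noteq> {}" for i
    using g(1)[of i] by (auto simp: A_def)
  have "\<exists>x. x \<in> {0<..<1} \<and> x \<notin> \<rat> \<and> (\<forall>i. cf_quotient (Suc i) x = w i)" if "w \<in> Pi\<^sub>E UNIV A" for w
  proof -
    have "w i \<ge> 1" for i
    proof -
      have "w i \<in> A i" using that by (auto simp: PiE_iff)
      then show ?thesis using g2[of i] by (simp add: A_def)
    qed
    then show ?thesis using ex_irrational_cf_quotients[of w] by blast
  qed
  then obtain X where X: "\<And>w. w \<in> Pi\<^sub>E UNIV A \<Longrightarrow>
      X w \<in> {0<..<1} \<and> X w \<notin> \<rat> \<and> (\<forall>i. cf_quotient (Suc i) (X w) = w i)" by metis
  have XE: "X w \<in> E" if "w \<in> Pi\<^sub>E UNIV A" for w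
    using X[OF that] that by (intro E) (auto simp: A_def PiE_iff)
  define K where "K = 4 powr s * C"
  have "0 \<le> C" using order_trans[OF _ C[of 0]] by simp
  then have K: "K \<ge> 0" by (simp add: K_def)
  \<comment> \<open>With this total weight the cover would carry mass at most
    \<open>K / (K + 1) < 1\<close>, although it catches every \<open>X w\<close>; adding 1 also
    admits \<open>K = 0\<close>.\<close>
  obtain U :: "nat \<Rightarrow> real set" where U: "E \<subseteq> (\<Union>i. U i)" "\<And>i. bounded (U i)"
    "(\<Sum>i. ennreal (diam_weight s (U i))) \<le> ennreal (1 / (K + 1))"
    using hausdorff_measure_eq_0D[OF null, of "1 / (K + 1)"] K by auto
  have "\<exists>T\<in>sets P. {w \<in> Pi\<^sub>E UNIV A. X w \<in> U i} \<subseteq> T \<and> emeasure P T \<le> ennreal (K * diam_weight s (U i))" for i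
    unfolding P_def A_def[abs_def] K_def
    by (rule cf_cylinder_mass_le[OF g s C X[unfolded A_def[abs_def]] U(2)])
  then have "\<forall>i. \<exists>T. T \<in> sets P \<and> {w \<in> Pi\<^sub>E UNIV A. X w \<in> U i} \<subseteq> T \<and>
      emeasure P T \<le> ennreal (K * diam_weight s (U i))" by (auto simp: Bex_def)
  from choice[OF this] obtain T where T: "\<And>i. T i \<in> sets P" "\<And>i. {w \<in> Pi\<^sub>E UNIV A. X w \<in> U i} \<subseteq> T i"
    "\<And>i. emeasure P (T i) \<le> ennreal (K * diam_weight s (U i))" by blast
  interpret P: prob_space P
    unfolding P_def using A by (intro prob_space_PiM prob_space_uniform_count_measure) auto
  have "space P \<subseteq> (\<Union>i. T i)"
  proof
    fix w assume "w \<in> space P"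
    then have w: "w \<in> Pi\<^sub>E UNIV A" by (simp add: P_def space_PiM space_uniform_count_measure)
    then obtain i where "X w \<in> U i" using XE U(1) by blast
    then show "w \<in> (\<Union>i. T i)" using T(2)[of i] w by blast
  qed
  then have "1 \<le> emeasure P (\<Union>i. T i)"
    using T(1) by (subst P.emeasure_space_1[symmetric]) (intro emeasure_mono, auto)
  also have "\<dots> \<le> (\<Sum>i. emeasure P (T i))"
    using T(1) by (intro emeasure_subadditive_countably) auto
  also have "\<dots> \<le> (\<Sum>i. ennreal K * ennreal (diam_weight s (U i)))"
    using T(3) K by (intro suminf_le) (auto simp: ennreal_mult diam_weight_nonneg)
  also have "\<dots> = ennreal K * (\<Sum>i. ennreal (diam_weight s (U i)))" by simp
  also have "\<dots> \<le> ennreal K * ennreal (1 / (K + 1))" by (intro mult_left_mono U) simp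
  also have "\<dots> = ennreal (K / (K + 1))" using K by (simp flip: ennreal_mult)
  also have "\<dots> < 1" using K by (simp add: ennreal_less_one_iff)
  finally show False by simp
qed

section \<open>Blocks that realise a prescribed exponent\<close>

text \<open>Each block begins where the previous one ends, so every choice of quotients is
  non-decreasing, and \<open>n \<le> g n\<close> drives it to infinity.\<close>

lemma cf_blocks_nondecreasing:
  fixes g :: "nat \<Rightarrow> nat"
  assumes g: "\<And>n. g n < g (Suc n)"
    and x: "x \<in> {0<..<1}" "x \<notin> \<rat>" "\<And>i. cf_quotient (Suc i) x \<in> {g i..<g (Suc i)}"
  shows "x \<in> nondecreasing_cf_set"
proof -
  define q where "q i = cf_quotient (Suc i) x" for i
  have q: "g i \<le> q i" "q i < g (Suc i)" for i using x(3)[of i] by (auto simp: q_def)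
  have mono: "q i \<le> q j" if "i \<le> j" for i j
    by (rule lift_Suc_mono_le[OF _ that]) (meson q less_imp_le order_trans)
  have "mono_on {1..} (\<lambda>n. cf_quotient n x)"
  proof (rule mono_onI)
    fix m n :: nat assume "m \<in> {1..}" "n \<in> {1..}" "m \<le> n"
    then show "cf_quotient m x \<le> cf_quotient n x"
      using mono[of "m - 1" "n - 1"] by (simp add: q_def)
  qed
  moreover have "filterlim (\<lambda>n. cf_quotient n x) at_top sequentially"
  proof -
    have "n \<le> g n" for n by (induction n) (auto intro: Suc_leI le_less_trans[OF _ g])
    then have "n \<le> cf_quotient (Suc n) x" for n using q(1)[of n] by (auto simp: q_def intro: order_trans)
    then have "filterlim (\<lambda>n. cf_quotient (Suc n) x) at_top sequentially"
      by (intro filterlim_at_top_mono[OF filterlim_ident]) auto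
    then show ?thesis by (rule filterlim_sequentially_Suc[THEN iffD1])
  qed
  ultimately show ?thesis using x(1,2) by (simp add: nondecreasing_cf_set_def)
qed

lemma conv_exponent_eqI:
  assumes "\<alpha> \<ge> 0"
    and "\<And>s. s > \<alpha> \<Longrightarrow> summable (\<lambda>n. real (cf_quotient (Suc n) x) powr (-s))"
    and "\<And>s. s \<ge> 0 \<Longrightarrow> summable (\<lambda>n. real (cf_quotient (Suc n) x) powr (-s)) \<Longrightarrow> \<alpha> \<le> s"
  shows "conv_exponent x = ennreal \<alpha>"
proof (rule antisym)
  show "conv_exponent x \<le> ennreal \<alpha>"
  proof (rule ennreal_le_epsilon)
    fix e :: real assume "e > 0"
    then have "conv_exponent x \<le> ennreal (\<alpha> + e)"
      unfolding conv_exponent_def using assms(1) assms(2)[of "\<alpha> + e"] by (intro INF_lower) auto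
    then show "conv_exponent x \<le> ennreal \<alpha> + ennreal e"
      using assms(1) \<open>e > 0\<close> by (simp add: ennreal_plus)
  qed
  show "ennreal \<alpha> \<le> conv_exponent x"
    unfolding conv_exponent_def using assms(3) by (intro INF_greatest) (auto intro: ennreal_leI)
qed

text \<open>Provides the constant of the mass estimate. Factors tending to 0 beat any geometric
  growth: once \<open>B\<close> is absorbed into each factor, consecutive products have ratio at
  most 1/2 eventually.\<close>

lemma prod_tendsto_0_times_geometric_bounded:
  fixes f e :: "nat \<Rightarrow> real"
  assumes f: "f \<longlonglongrightarrow> 0" and e: "\<And>n. e n \<le> K * B ^ n" and f0: "\<And>n. f n \<ge> 0" and B: "B > 0"
  shows "\<exists>C. \<forall>n. (\<Prod>i<n. f i) * e n \<le> C"
proof -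
  define u where "u n = (\<Prod>i<n. f i * B)" for n
  have u: "u n \<ge> 0" for n using f0 B by (simp add: u_def prod_nonneg)
  have "\<forall>\<^sub>F n in sequentially. f n < 1 / (2 * B)"
    using f B by (intro order_tendstoD) auto
  then obtain N where N: "\<And>n. n \<ge> N \<Longrightarrow> f n < 1 / (2 * B)" by (auto simp: eventually_sequentially)
  have "summable u"
  proof (rule summable_ratio_test[of "1/2" N])
    fix n assume "n \<ge> N"
    then have "f n * B \<le> 1 / 2" using N[of n] B by (simp add: field_simps)
    then have "u n * (f n * B) \<le> u n * (1 / 2)" by (intro mult_left_mono u)
    then show "norm (u (Suc n)) \<le> 1/2 * norm (u n)"
      using u[of n] u[of "Suc n"] by (simp add: u_def)
  qed simp
  then have "Bseq u"
    using summable_LIMSEQ_zero convergent_imp_Bseq convergentI by blast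
  then obtain L where L: "\<And>n. u n \<le> L" unfolding Bseq_def by (metis abs_le_D1 real_norm_def)
  have "(\<Prod>i<n. f i) * e n \<le> \<bar>K\<bar> * L" for n
  proof -
    have "(\<Prod>i<n. f i) * e n \<le> (\<Prod>i<n. f i) * (\<bar>K\<bar> * B ^ n)"
    proof (rule mult_left_mono)
      have "K * B ^ n \<le> \<bar>K\<bar> * B ^ n" using B by (intro mult_right_mono) auto
      then show "e n \<le> \<bar>K\<bar> * B ^ n" using e[of n] by linarith
    qed (use f0 in \<open>simp add: prod_nonneg\<close>)
    also have "\<dots> = \<bar>K\<bar> * u n" by (simp add: u_def prod.distrib)
    also have "\<dots> \<le> \<bar>K\<bar> * L" using L by (intro mult_left_mono) auto
    finally show ?thesis .
  qed
  then show ?thesis by blast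
qed

lemma power_powr_swap: "x > 0 \<Longrightarrow> (x ^ n) powr a = (x powr a) ^ n" for x a :: real
  by (simp add: powr_powr mult.commute flip: powr_realpow)

text \<open>For dyadic blocks the factors in the mass estimate are a constant times
  \<open>(b / 2) ^ i\<close> with \<open>b = 4 powr s\<close>, and \<open>b < 2\<close> is the
  condition \<open>s < 1 / 2\<close>. Exponential growth of the quotients makes the series converge
  for every positive power.\<close>

lemma hausdorff_measure_level_0_pos:
  assumes "0 \<le> s" "s < 1 / 2"
  shows "hausdorff_measure s {x \<in> nondecreasing_cf_set. conv_exponent x = ennreal 0} \<noteq> 0"
proof -
  define g :: "nat \<Rightarrow> nat" where "g i = 2 ^ Suc i" for i
  have N: "real (g (Suc i) - g i) = 2 ^ Suc i" for i by (simp add: g_def)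
  define b :: real where "b = 4 powr s"
  have "b < 4 powr (1/2)" using assms unfolding b_def by (intro powr_less_mono) auto
  then have b: "0 < b" "b < 2" by (simp_all add: b_def powr_half_sqrt)
  have gb: "(real (g (Suc i)))\<^sup>2 powr s = b ^ (i + 2)" for i
  proof -
    have "(real (g (Suc i)))\<^sup>2 = (2 ^ 2) ^ (i + 2)"
      unfolding g_def of_nat_power power_mult[symmetric] by (simp add: mult.commute)
    also have "\<dots> = 4 powr real (i + 2)" by (subst powr_realpow) auto
    finally have "(real (g (Suc i)))\<^sup>2 powr s = (4 powr s) powr real (i + 2)"
      by (simp only: powr_powr mult.commute)
    also have "\<dots> = b ^ (i + 2)" using b(1) by (simp only: powr_realpow flip: b_def)
    finally show ?thesis .
  qed
  have "(\<lambda>i. (b / 2) ^ i * (b\<^sup>2 / 2)) \<longlonglongrightarrow> 0"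
    using b by (intro tendsto_mult_left_zero LIMSEQ_power_zero) simp
  then have "(\<lambda>i. (real (g (Suc i)))\<^sup>2 powr s / real (g (Suc i) - g i)) \<longlonglongrightarrow> 0"
    unfolding gb N by (simp add: power_divide power2_eq_square mult_ac)
  moreover have "((real (g (Suc n)))\<^sup>2 / real (g (Suc n) - g n)) powr s \<le> b\<^sup>2 * b ^ n" for n
  proof -
    \<comment> \<open>Dropping the block length is harmless, since this factor only has to grow at
      most geometrically.\<close>
    have "(real (g (Suc n)))\<^sup>2 / 2 ^ Suc n \<le> (real (g (Suc n)))\<^sup>2 / 1"
      by (intro divide_left_mono one_le_power) auto
    then have "((real (g (Suc n)))\<^sup>2 / real (g (Suc n) - g n)) powr s \<le> (real (g (Suc n)))\<^sup>2 powr s"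
      unfolding N using assms(1) by (intro powr_mono2) auto
    also have "\<dots> = b\<^sup>2 * b ^ n" unfolding gb by (simp add: power2_eq_square mult_ac)
    finally show ?thesis .
  qed
  ultimately have "\<exists>C. \<forall>n. (\<Prod>i<n. (real (g (Suc i)))\<^sup>2 powr s / real (g (Suc i) - g i)) *
      ((real (g (Suc n)))\<^sup>2 / real (g (Suc n) - g n)) powr s \<le> C"
    by (rule prod_tendsto_0_times_geometric_bounded) (use b(1) in auto)
  then obtain C where C: "\<And>n. (\<Prod>i<n. (real (g (Suc i)))\<^sup>2 powr s / real (g (Suc i) - g i)) *
      ((real (g (Suc n)))\<^sup>2 / real (g (Suc n) - g n)) powr s \<le> C" by blast
  show ?thesis
  proof (rule hausdorff_measure_cf_cantor_pos[of g s C])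
    fix x :: real
    assume x: "x \<in> {0<..<1}" "x \<notin> \<rat>" "\<And>i. cf_quotient (Suc i) x \<in> {g i..<g (Suc i)}"
    have "x \<in> nondecreasing_cf_set"
      by (rule cf_blocks_nondecreasing[OF _ x]) (simp add: g_def)
    moreover have "conv_exponent x = ennreal 0"
    proof (rule conv_exponent_eqI)
      fix t :: real assume "t > 0"
      show "summable (\<lambda>n. real (cf_quotient (Suc n) x) powr (-t))"
      proof (rule summable_comparison_test)
        show "summable (\<lambda>n. (2 powr (-t)) ^ Suc n)"
          using \<open>t > 0\<close> by (subst summable_Suc_iff) (simp add: summable_geometric powr_less_one)
        have "norm (real (cf_quotient (Suc n) x) powr (-t)) \<le> (2 powr (-t)) ^ Suc n" for n
        proof -
          have "2 ^ Suc n \<le> cf_quotient (Suc n) x" using x(3)[of n] by (simp add: g_def)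
          then have "(2::real) ^ Suc n \<le> real (cf_quotient (Suc n) x)"
            by (metis of_nat_le_iff of_nat_numeral of_nat_power)
          then have "real (cf_quotient (Suc n) x) powr (-t) \<le> (2 ^ Suc n) powr (-t)"
            using \<open>t > 0\<close> by (intro powr_mono2') auto
          also have "\<dots> = (2 powr (-t)) ^ Suc n"
            by (rule power_powr_swap) simp
          finally show ?thesis by simp
        qed
        then show "\<exists>N. \<forall>n\<ge>N. norm (real (cf_quotient (Suc n) x) powr (-t)) \<le> (2 powr (-t)) ^ Suc n" by blast
      qed
    qed simp_all
    ultimately show "x \<in> {x \<in> nondecreasing_cf_set. conv_exponent x = ennreal 0}" by simp
  qed (use assms C in \<open>auto simp: g_def\<close>)
qed

text \<open>An elementary substitute for the mean value theorem; it bounds the block lengths from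
  below.\<close>

lemma powr_Suc_ge:
  fixes x b :: real
  assumes "x > 0" "b \<ge> 1"
  shows "x powr b + x powr (b - 1) \<le> (x + 1) powr b"
proof -
  have "x powr b + x powr (b - 1) = (x + 1) * x powr (b - 1)"
    using assms(1) by (simp add: powr_diff field_simps)
  also have "\<dots> \<le> (x + 1) * (x + 1) powr (b - 1)"
    using assms by (intro mult_left_mono powr_mono2) auto
  also have "\<dots> = (x + 1) powr b"
    using assms(1) by (simp add: powr_diff)
  finally show ?thesis .
qed

text \<open>Quotients of order \<open>n powr \<beta>\<close> with
  \<open>\<beta> = 1 / \<alpha>\<close> give the exponent \<alpha>. The blocks have length at least
  \<open>(i + 2) powr (\<beta> - 1)\<close>, so the factors in the mass estimate are at most of
  order \<open>(i + 2) powr (2 * \<beta> * s - (\<beta> - 1))\<close>, a negative power precisely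
  for \<open>s < (1 - \<alpha>) / 2\<close>.\<close>

lemma hausdorff_measure_level_pos:
  assumes "0 < \<alpha>" "\<alpha> < 1" "0 \<le> s" "s < (1 - \<alpha>) / 2"
  shows "hausdorff_measure s {x \<in> nondecreasing_cf_set. conv_exponent x = ennreal \<alpha>} \<noteq> 0"
proof -
  define \<beta> where "\<beta> = 1 / \<alpha>"
  have \<beta>: "\<beta> > 1" using assms by (simp add: \<beta>_def)
  \<comment> \<open>The leading 2 leaves room for rounding: gaps of at least
    \<open>2 * (i + 2) powr (\<beta> - 1)\<close> lose less than 1 and still contain two
    integers.\<close>
  define h where "h i = 2 * (real i + 2) powr \<beta>" for i :: nat
  define g where "g i = nat \<lceil>h i\<rceil>" for i
  \<comment> \<open>From \<open>h (Suc i) + 1 \<le> 3 * (i + 3) powr \<beta>\<close> and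
    \<open>i + 3 \<le> 2 * (i + 2)\<close>.\<close>
  define c where "c = 3 * 2 powr \<beta>"
  have z1: "1 \<le> (real i + 2) powr p" if "p \<ge> 0" for i :: nat and p
    using that by (intro ge_one_powr_ge_zero) auto
  have h: "h i \<le> real (g i)" "real (g i) < h i + 1" "h i \<ge> 2" for i
  proof -
    show "h i \<ge> 2" using z1[of \<beta> i] \<beta> by (simp add: h_def)
    then show "h i \<le> real (g i)" "real (g i) < h i + 1" unfolding g_def by linarith+
  qed
  have gap: "h i + 2 * (real i + 2) powr (\<beta> - 1) \<le> h (Suc i)" for i
    using powr_Suc_ge[of "real i + 2" \<beta>] \<beta> by (simp add: h_def algebra_simps)
  have g2: "g i + 2 \<le> g (Suc i)" for i
  proof -
    have "h i + 2 \<le> h (Suc i)" using gap[of i] z1[of "\<beta> - 1" i] \<beta> by simp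
    then show ?thesis using h(3)[of i] unfolding g_def by linarith
  qed
  have N: "(real i + 2) powr (\<beta> - 1) \<le> real (g (Suc i) - g i)" for i
    using gap[of i] h(2)[of i] h(1)[of "Suc i"] z1[of "\<beta> - 1" i] \<beta> g2[of i] by (simp add: of_nat_diff)
  have gc: "real (g (Suc i)) \<le> c * (real i + 2) powr \<beta>" for i
  proof -
    have "real (g (Suc i)) \<le> 3 * (real (Suc i) + 2) powr \<beta>"
      using h(2)[of "Suc i"] z1[of \<beta> "Suc i"] \<beta> unfolding h_def by linarith
    also have "(real (Suc i) + 2) powr \<beta> \<le> (2 * (real i + 2)) powr \<beta>"
      using \<beta> by (intro powr_mono2) auto
    also have "\<dots> = 2 powr \<beta> * (real i + 2) powr \<beta>" by (subst powr_mult) auto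
    finally show ?thesis by (simp add: c_def)
  qed
  have "c \<ge> 0" by (simp add: c_def)
  have gsq: "(real (g (Suc i)))\<^sup>2 \<le> c\<^sup>2 * (real i + 2) powr (2 * \<beta>)" for i
  proof -
    have "(real (g (Suc i)))\<^sup>2 \<le> (c * (real i + 2) powr \<beta>)\<^sup>2"
      using gc by (intro power_mono) auto
    also have "\<dots> = c\<^sup>2 * (real i + 2) powr (2 * \<beta>)"
      by (simp add: power_mult_distrib power2_eq_square flip: powr_add)
    finally show ?thesis .
  qed
  define C2 where "C2 = (c\<^sup>2) powr s"
  have "\<beta> - 1 - 2 * \<beta> * s > 0"
  proof -
    \<comment> \<open>This product equals the required exponent because
      \<open>\<beta> * \<alpha> = 1\<close>.\<close>
    have "\<beta> * (1 - \<alpha> - 2 * s) > 0"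
    proof (rule mult_pos_pos)
      show "\<beta> > 0" using \<beta> by simp
      show "1 - \<alpha> - 2 * s > 0" using assms(4) by (simp add: field_simps)
    qed
    moreover have "\<beta> * \<alpha> = 1" using assms(1) by (simp add: \<beta>_def)
    ultimately show ?thesis by (simp add: algebra_simps)
  qed
  then have "(\<lambda>i. C2 * (real i + 2) powr (-(\<beta> - 1 - 2 * \<beta> * s))) \<longlonglongrightarrow> 0"
    by (intro tendsto_mult_right_zero tendsto_neg_powr filterlim_at_top_mono[OF filterlim_real_sequentially])
       auto
  then have "(\<lambda>i. (real (g (Suc i)))\<^sup>2 powr s / real (g (Suc i) - g i)) \<longlonglongrightarrow> 0"
  proof (rule tendsto_0_le[where K = 1], intro always_eventually allI)
    fix i
    define z where "z = real i + 2"
    have "z > 0" by (simp add: z_def)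
    have "(real (g (Suc i)))\<^sup>2 powr s / real (g (Suc i) - g i) \<le> (c\<^sup>2 * z powr (2 * \<beta>)) powr s / z powr (\<beta> - 1)"
      using gsq[of i] N[of i] assms(3) \<open>z > 0\<close> unfolding z_def
      by (intro frac_le powr_mono2) auto
    also have "\<dots> = C2 * z powr (-(\<beta> - 1 - 2 * \<beta> * s))"
      by (simp add: powr_mult powr_powr C2_def powr_diff powr_minus powr_add divide_simps mult_ac)
    finally show "norm ((real (g (Suc i)))\<^sup>2 powr s / real (g (Suc i) - g i))
        \<le> norm (C2 * (real i + 2) powr (-(\<beta> - 1 - 2 * \<beta> * s))) * 1"
      by (simp add: z_def C2_def)
  qed
  moreover have "((real (g (Suc n)))\<^sup>2 / real (g (Suc n) - g n)) powr s
      \<le> (C2 * 2 powr (2 * \<beta> * s)) * (2 powr (2 * \<beta> * s)) ^ n" for n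
  proof -
    have "(real (g (Suc n)))\<^sup>2 / real (g (Suc n) - g n) \<le> (real (g (Suc n)))\<^sup>2 / 1"
      using g2[of n] by (intro divide_left_mono) auto
    also have "\<dots> \<le> c\<^sup>2 * (real n + 2) powr (2 * \<beta>)" using gsq by simp
    also have "\<dots> \<le> c\<^sup>2 * (2 ^ Suc n) powr (2 * \<beta>)"
    proof (intro mult_left_mono powr_mono2)
      have "n + 2 \<le> 2 ^ Suc n" by (induction n) auto
      then show "real n + 2 \<le> 2 ^ Suc n" using of_nat_mono[of "n + 2" "2 ^ Suc n", where ?'a = real] by simp
    qed (use \<beta> in auto)
    finally have "((real (g (Suc n)))\<^sup>2 / real (g (Suc n) - g n)) powr s \<le> (c\<^sup>2 * (2 ^ Suc n) powr (2 * \<beta>)) powr s"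
      using assms(3) by (intro powr_mono2) auto
    also have "\<dots> = C2 * ((2 ^ Suc n) powr (2 * \<beta> * s))"
      by (simp add: powr_mult powr_powr C2_def)
    also have "(2 ^ Suc n) powr (2 * \<beta> * s) = (2 powr (2 * \<beta> * s)) ^ Suc n"
      by (rule power_powr_swap) simp
    finally show ?thesis by (simp add: mult_ac)
  qed
  ultimately have "\<exists>C. \<forall>n. (\<Prod>i<n. (real (g (Suc i)))\<^sup>2 powr s / real (g (Suc i) - g i)) *
      ((real (g (Suc n)))\<^sup>2 / real (g (Suc n) - g n)) powr s \<le> C"
    by (rule prod_tendsto_0_times_geometric_bounded) (use \<beta> in auto)
  then obtain C where C: "\<And>n. (\<Prod>i<n. (real (g (Suc i)))\<^sup>2 powr s / real (g (Suc i) - g i)) *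
      ((real (g (Suc n)))\<^sup>2 / real (g (Suc n) - g n)) powr s \<le> C" by blast
  show ?thesis
  proof (rule hausdorff_measure_cf_cantor_pos[of g s C])
    show "g n + 2 \<le> g (Suc n)" for n by (rule g2)
    show "g 0 \<ge> 2" using h(1,3)[of 0] by linarith
    fix x :: real
    assume x: "x \<in> {0<..<1}" "x \<notin> \<rat>" "\<And>i. cf_quotient (Suc i) x \<in> {g i..<g (Suc i)}"
    have "g n < g (Suc n)" for n using g2[of n] by simp
    then have "x \<in> nondecreasing_cf_set"
      using cf_blocks_nondecreasing x by blast
    moreover have "conv_exponent x = ennreal \<alpha>"
    proof (rule conv_exponent_eqI)
      fix t :: real assume "t > \<alpha>"
      then have t: "t > 0" "\<beta> * t > 1" using assms by (auto simp: \<beta>_def)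
      show "summable (\<lambda>n. real (cf_quotient (Suc n) x) powr (-t))"
      proof (rule summable_comparison_test)
        show "summable (\<lambda>n. real (Suc n) powr (-(\<beta> * t)))"
          using t(2) summable_Suc_iff[of "\<lambda>n. real n powr (-(\<beta> * t))"]
          by (subst (asm) summable_real_powr_iff) simp
        have "norm (real (cf_quotient (Suc n) x) powr (-t)) \<le> real (Suc n) powr (-(\<beta> * t))" for n
        proof -
          have "real (Suc n) powr \<beta> \<le> (real n + 2) powr \<beta>" using \<beta> by (intro powr_mono2) auto
          also have "\<dots> \<le> h n" by (simp add: h_def)
          also have "\<dots> \<le> real (cf_quotient (Suc n) x)" using h(1)[of n] x(3)[of n] by auto
          finally have "real (cf_quotient (Suc n) x) powr (-t) \<le> (real (Suc n) powr \<beta>) powr (-t)"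
            using t(1) by (intro powr_mono2') auto
          then show ?thesis by (simp add: powr_powr)
        qed
        then show "\<exists>N. \<forall>n\<ge>N. norm (real (cf_quotient (Suc n) x) powr (-t)) \<le> real (Suc n) powr (-(\<beta> * t))" by blast
      qed
    next
      fix t :: real assume t: "t \<ge> 0" "summable (\<lambda>n. real (cf_quotient (Suc n) x) powr (-t))"
      \<comment> \<open>The upper bound \<open>c * (n + 2) powr \<beta>\<close> on the quotients
        transfers convergence to a p-series, which forces \<open>\<beta> * t > 1\<close>.\<close>
      have "summable (\<lambda>n. real (n + 2) powr (-(\<beta> * t)))"
      proof (rule summable_comparison_test)
        show "summable (\<lambda>n. c powr t * real (cf_quotient (Suc n) x) powr (-t))"
          using t(2) by (rule summable_mult)
        have "norm (real (n + 2) powr (-(\<beta> * t))) \<le> c powr t * real (cf_quotient (Suc n) x) powr (-t)" for n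
        proof -
          have "real (cf_quotient (Suc n) x) \<le> c * (real n + 2) powr \<beta>"
            using gc[of n] x(3)[of n] by auto
          moreover have "0 < cf_quotient (Suc n) x"
            using x(3)[of n] h(1,3)[of n] by (metis atLeastLessThan_iff gr0I le_zero_eq not_numeral_le_zero of_nat_0 order_trans)
          ultimately have "(c * (real n + 2) powr \<beta>) powr (-t) \<le> real (cf_quotient (Suc n) x) powr (-t)"
            using t(1) by (intro powr_mono2') auto
          also have "(c * (real n + 2) powr \<beta>) powr (-t) = c powr (-t) * (real n + 2) powr (-(\<beta> * t))"
            using \<open>c \<ge> 0\<close> by (simp add: powr_mult powr_powr)
          finally have "c powr t * (c powr (-t) * (real n + 2) powr (-(\<beta> * t)))
              \<le> c powr t * real (cf_quotient (Suc n) x) powr (-t)"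
            by (intro mult_left_mono) auto
          moreover have "c powr t * c powr (-t) = 1" by (simp add: c_def flip: powr_add)
          ultimately show ?thesis by (simp add: add.commute flip: mult.assoc)
        qed
        then show "\<exists>N. \<forall>n\<ge>N. norm (real (n + 2) powr (-(\<beta> * t))) \<le> c powr t * real (cf_quotient (Suc n) x) powr (-t)" by blast
      qed
      then have "summable (\<lambda>n. real n powr (-(\<beta> * t)))"
        by (subst (asm) summable_iff_shift)
      then have "\<beta> * t > 1" by (subst (asm) summable_real_powr_iff) simp
      then show "\<alpha> \<le> t" using assms(1) by (simp add: \<beta>_def)
    qed (use assms in simp)
    ultimately show "x \<in> {x \<in> nondecreasing_cf_set. conv_exponent x = ennreal \<alpha>}" by simp
  qed (use assms C in auto)
qed

theorem theorem2p4:
  fixes \<alpha> :: real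
  assumes "\<alpha> \<ge> 0"
  shows "hausdorff_dim {x \<in> nondecreasing_cf_set. conv_exponent x = ennreal \<alpha>} =
           (if \<alpha> \<le> 1 then ennreal ((1 - \<alpha>) / 2) else 0)"
proof -
  let ?A = "{x \<in> nondecreasing_cf_set. conv_exponent x = ennreal \<alpha>}"
  \<comment> \<open>The maximum merges both cases of the claim; for \<alpha> \<ge> 1 it is
    0.\<close>
  define d where "d = max 0 ((1 - \<alpha>) / 2)"
  have d: "0 \<le> d" "(1 - \<alpha>) / 2 \<le> d" by (auto simp: d_def)
  have "hausdorff_dim ?A \<le> ennreal d"
  proof (rule ennreal_le_epsilon)
    fix e :: real assume "e > 0"
    then have "hausdorff_measure (d + e) ?A = 0"
      using assms d by (intro hausdorff_measure_level_null) linarith+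
    then have "hausdorff_dim ?A \<le> ennreal (d + e)"
      unfolding hausdorff_dim_def using \<open>e > 0\<close> by (intro INF_lower) (auto simp: d_def)
    then show "hausdorff_dim ?A \<le> ennreal d + ennreal e"
      using \<open>e > 0\<close> by (simp add: ennreal_plus d_def)
  qed
  moreover have "ennreal d \<le> hausdorff_dim ?A"
    unfolding hausdorff_dim_def
  proof (rule INF_greatest)
    fix s assume s: "s \<in> {s. 0 \<le> s \<and> hausdorff_measure s ?A = 0}"
    have "d \<le> s"
    proof (rule ccontr)
      assume "\<not> d \<le> s"
      \<comment> \<open>As \<open>s \<ge> 0\<close>, a failure of \<open>d \<le> s\<close> means
        \<open>d > 0\<close>, which leaves only \<alpha> < 1.\<close>
      then have "\<alpha> < 1" "s < (1 - \<alpha>) / 2" using s by (auto simp: d_def max_def split: if_splits)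
      then show False
        using hausdorff_measure_level_0_pos[of s] hausdorff_measure_level_pos[of \<alpha> s] assms s
        by (cases "\<alpha> = 0") auto
    qed
    then show "ennreal d \<le> ennreal s" by (rule ennreal_leI)
  qed
  ultimately have "hausdorff_dim ?A = ennreal d" by (rule antisym)
  then show ?thesis by (auto simp: d_def max_def field_simps)
qed

end
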